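(* Let $D$ be the covariant derivative on $\mathcal{S}=\mathcal{S}_-\oplus\mathcal{S}_+$ given by the $q$-monopole as spin connection and define the Dirac operator on $\mathbb{C}_q[S^2]$ by $$\nabla\!\!\!\!/=\gamma\circ D=\begin{pmatrix}0&\gamma\circ\bar{\mathfrak{\Delta}}\\ \gamma\circ\mathfrak{\Delta}&0\end{pmatrix}:\mathcal{S}\to\mathcal{S},$$ where $D=\mathfrak{\Delta}+\bar{\mathfrak{\Delta}}$ according to the parts in $\Omega^{1,0}$ and $\Omega^{0,1}$. Then $\nabla\!\!\!\!/$ is covariant under the left coaction of $\mathbb{C}_q[SL_2]$ and under local frame rotations $\mathbb{C}[t,t^{-1}]$. Moreover, for $f=b_-,\ 1+[2]_qb_0,\ b_+$ (the cases in braces listed in this order) we have $$\nabla\!\!\!\!/^{\,2}(fa)=q^{-1}[2]_q(\square f)a+\begin{cases}0\\ -q^{-1}a\\ -q^{-1}c\end{cases},\qquad \nabla\!\!\!\!/^{\,2}(fb)=q^{-1}[2]_q(\square f)b+\begin{cases}0\\ q b\\ q d\end{cases},$$ $$\nabla\!\!\!\!/^{\,2}(fc)=q^{-1}[2]_q(\square f)c+\begin{cases}a\\ q c\\ 0\end{cases},\qquad \nabla\!\!\!\!/^{\,2}(fd)=q^{-1}[2]_q(\square f)d+\begin{cases}-q^2b\\ -q^3d\\ 0\end{cases}.$$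
   Context: $q\in\mathbb{C}$ is invertible, $[2]_q=q+q^{-1}$, $[n;q^2]=(1-q^{2n})/(1-q^2)$; $\bar\otimes$ is the tensor product over $\mathbb{C}_q[S^2]$. $\mathbb{C}_q[SL_2]$ is the Hopf algebra generated by $a,b,c,d$ with $ba=qab$, $ca=qac$, $db=qbd$, $dc=qcd$, $bc=cb$, $ad=1+q^{-1}bc$, $da=1+qbc$ and matrix coproduct. It is $\mathbb{Z}$-graded by $\deg a=\deg c=1$, $\deg b=\deg d=-1$ (equivalently, a right coaction $x\mapsto x\otimes t^{\deg x}$ of $\mathbb{C}[t,t^{-1}]$); $\mathbb{C}_q[SL_2]_n$ is the degree $n$ component. $\mathbb{C}_q[S^2]=\mathbb{C}_q[SL_2]_0$ is generated by $b_0=bc$, $b_+=cd$, $b_-=ab$. $\Omega^1(\mathbb{C}_q[SL_2])$ is the left-covariant bimodule calculus that is free as a left module on left-invariant forms $e^+,e^-,e^0$, with $e^\pm x=q^{\deg x}x\,e^\pm$ and $e^0x=q^{2\deg x}x\,e^0$ for homogeneous $x$, and $$\mathrm{d}a=ae^0+qbe^+,\quad \mathrm{d}b=ae^--q^{-2}be^0,\quad \mathrm{d}c=ce^0+qde^+,\quad \mathrm{d}d=ce^--q^{-2}de^0.$$ It extends to an exterior algebra with $(e^\pm)^2=(e^0)^2=0$, $q^2e^+\wedge e^-+e^-\wedge e^+=0$, $e^0\wedge e^\pm+q^{\pm4}e^\pm\wedge e^0=0$, $\mathrm{d}e^0=q^3e^+\wedge e^-$, $\mathrm{d}e^\pm=\mp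 q^{\pm2}(1+q^{-2})e^\pm\wedge e^0$. $\Omega(\mathbb{C}_q[S^2])$ is the differential subalgebra generated by $\mathbb{C}_q[S^2]$ and $\mathrm{d}\mathbb{C}_q[S^2]$. $\Omega^1(\mathbb{C}_q[S^2])=\Omega^{1,0}\oplus\Omega^{0,1}$ with $\Omega^{1,0}=\mathbb{C}_q[SL_2]_{-2}e^+$, $\Omega^{0,1}=\mathbb{C}_q[SL_2]_2e^-$; $\Omega^2(\mathbb{C}_q[S^2])=\mathbb{C}_q[S^2]\Upsilon$, $\Upsilon=e^+\wedge e^-$. The Hodge operator is the left module map with $*(fe^\pm)=\pm fe^\pm$, $*1=\Upsilon$, $*\Upsilon=1$, and the Laplacian on $\mathbb{C}_q[S^2]$ is $\square=-\frac12*\mathrm{d}*\mathrm{d}$. Spinors: $\mathcal{S}_-=\mathbb{C}_q[SL_2]_1$ and $\mathcal{S}_+=\mathbb{C}_q[SL_2]_{-1}$ (charge $\mp1$ monopole bundles). The covariant derivative from the $q$-monopole connection $\omega(t^n)=[n;q^2]e^0$ is $D\sigma=\mathrm{d}\sigma-[n;q^2]\sigma e^0$ for $\sigma$ of degree $n$ ($n=1$ on $\mathcal{S}_-$, $n=-1$ on $\mathcal{S}_+$), regarded as an element of $\Omega^1(\mathbb{C}_q[S^2])\bar\otimes\mathbb{C}_q[SL_2]_n$ via the injective multiplication map $\tau\bar\otimes\sigma\mapsto\tau\sigma\in\Omega^1(\mathbb{C}_q[SL_2])$. The map $\gamma:\Omega^1(\mathbb{C}_q[S^2])\bar\otimes\mathcal{S}\to\mathcal{S}$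 is $\gamma(fe^+\bar\otimes\sigma)=f\sigma\in\mathcal{S}_+$ for $f\in\mathbb{C}_q[SL_2]_{-2}$, $\sigma\in\mathcal{S}_-$; $\gamma(fe^-\bar\otimes\tau)=f\tau\in\mathcal{S}_-$ for $f\in\mathbb{C}_q[SL_2]_2$, $\tau\in\mathcal{S}_+$; and zero on $\Omega^{0,1}\bar\otimes\mathcal{S}_-$ and $\Omega^{1,0}\bar\otimes\mathcal{S}_+$. The left coaction of $\mathbb{C}_q[SL_2]$ on $\mathcal{S}$ is the restriction of the coproduct. Covariance under local frame rotations means that $\nabla\!\!\!\!/$ is well defined on the spaces of $\mathbb{C}[t,t^{-1}]$-invariant sections $\mathcal{S}_\pm$ and so respects the degrees, mapping $\mathcal{S}_\mp$ to $\mathcal{S}_\pm$. In the $\nabla\!\!\!\!/^{\,2}$ formulae $a,c\in\mathcal{S}_-$ and $b,d\in\mathcal{S}_+$. *)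

theory Defs
  imports Complex_Main "HOL-Library.Poly_Mapping"
begin

section \<open>The free algebra on four generators\<close>

datatype qgen = GA | GB | GC | GD

datatype qword = QWord (letters: "qgen list")

text \<open>Words form a monoid under concatenation (written additively), so that
  the type of finitely supported functions from words to complex numbers, with the convolution
  product of \<^theory>\<open>HOL-Library.Poly_Mapping\<close>, is the free algebra.\<close>

instantiation qword :: monoid_add
begin

definition zero_qword :: qword where
  "0 = QWord []"

definition plus_qword :: "qword \<Rightarrow> qword \<Rightarrow> qword" where
  "u + v = QWord (letters u @ letters v)"

instance
  by standard (simp_all add: zero_qword_def plus_qword_def)

end

abbreviation qvar :: "qgen \<Rightarrow> qword \<Rightarrow>\<^sub>0 complex" where
  "qvar g \<equiv> Poly_Mapping.single (QWord [g]) 1"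

abbreviation qconst :: "complex \<Rightarrow> qword \<Rightarrow>\<^sub>0 complex" where
  "qconst z \<equiv> Poly_Mapping.single 0 z"

inductive_set two_sided_ideal :: "'r::ring_1 set \<Rightarrow> 'r set" for R where
  zero: "0 \<in> two_sided_ideal R"
| gen: "r \<in> R \<Longrightarrow> x * r * y \<in> two_sided_ideal R"
| add: "x \<in> two_sided_ideal R \<Longrightarrow> y \<in> two_sided_ideal R \<Longrightarrow> x + y \<in> two_sided_ideal R"

definition qsl2_relations :: "complex \<Rightarrow> (qword \<Rightarrow>\<^sub>0 complex) set" where
  "qsl2_relations q =
    {qvar GB * qvar GA - qconst q * qvar GA * qvar GB,
     qvar GC * qvar GA - qconst q * qvar GA * qvar GC,
     qvar GD * qvar GB - qconst q * qvar GB * qvar GD,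
     qvar GD * qvar GC - qconst q * qvar GC * qvar GD,
     qvar GB * qvar GC - qvar GC * qvar GB,
     qvar GA * qvar GD - 1 - qconst (inverse q) * qvar GB * qvar GC,
     qvar GD * qvar GA - 1 - qconst q * qvar GB * qvar GC}"

primrec gen_deg :: "qgen \<Rightarrow> int" where
  "gen_deg GA = 1"
| "gen_deg GB = -1"
| "gen_deg GC = 1"
| "gen_deg GD = -1"

definition word_deg :: "qword \<Rightarrow> int" where
  "word_deg w = sum_list (map gen_deg (letters w))"


section \<open>Tensor products\<close>

text \<open>The tensor product of a right module \<open>M\<close> and a left module \<open>N\<close> over \<open>R\<close>, all three being
  subsets of one ambient ring: the free abelian group on \<open>M \<times> N\<close> modulo biadditivity and
  \<open>R\<close>-balancedness. If \<open>R\<close> contains the scalars, complex bilinearity is part of balancedness.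
  An element is the set of all formal sums supported in \<open>M \<times> N\<close> which represent it.\<close>

inductive_set tnull :: "'w::ring_1 set \<Rightarrow> 'w set \<Rightarrow> 'w set \<Rightarrow> ('w \<times> 'w \<Rightarrow>\<^sub>0 int) set"
  for M R N where
  zero: "0 \<in> tnull M R N"
| add_left: "m \<in> M \<Longrightarrow> m' \<in> M \<Longrightarrow> n \<in> N \<Longrightarrow>
    frag_of (m + m', n) - frag_of (m, n) - frag_of (m', n) \<in> tnull M R N"
| add_right: "m \<in> M \<Longrightarrow> n \<in> N \<Longrightarrow> n' \<in> N \<Longrightarrow>
    frag_of (m, n + n') - frag_of (m, n) - frag_of (m, n') \<in> tnull M R N"
| balanced: "m \<in> M \<Longrightarrow> r \<in> R \<Longrightarrow> n \<in> N \<Longrightarrow>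
    frag_of (m * r, n) - frag_of (m, r * n) \<in> tnull M R N"
| diff: "u \<in> tnull M R N \<Longrightarrow> v \<in> tnull M R N \<Longrightarrow> u - v \<in> tnull M R N"

definition tclass ::
  "'w::ring_1 set \<Rightarrow> 'w set \<Rightarrow> 'w set \<Rightarrow> ('w \<times> 'w \<Rightarrow>\<^sub>0 int) \<Rightarrow> ('w \<times> 'w \<Rightarrow>\<^sub>0 int) set" where
  "tclass M R N u = {v. Poly_Mapping.keys v \<subseteq> M \<times> N \<and> v - u \<in> tnull M R N}"

definition tensor ::
  "'w::ring_1 set \<Rightarrow> 'w set \<Rightarrow> 'w set \<Rightarrow> ('w \<times> 'w \<Rightarrow>\<^sub>0 int) set set" where
  "tensor M R N = tclass M R N ` {u. Poly_Mapping.keys u \<subseteq> M \<times> N}"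

text \<open>The additive map on a tensor product induced by a balanced map \<open>h\<close>.\<close>

definition tlift :: "('w \<Rightarrow> 'w \<Rightarrow> 'w::ring_1) \<Rightarrow> ('w \<times> 'w \<Rightarrow>\<^sub>0 int) set \<Rightarrow> 'w" where
  "tlift h t = (THE y. \<forall>u\<in>t.
     y = (\<Sum>k\<in>Poly_Mapping.keys u. of_int (Poly_Mapping.lookup u k) * h (fst k) (snd k)))"

text \<open>On formal sums: the map \<open>f \<otimes> g\<close>, and the product \<open>(x \<otimes> y) (x' \<otimes> y') = x x' \<otimes> y y'\<close>.\<close>

definition fmap2 ::
  "('w \<Rightarrow> 'w) \<Rightarrow> ('w \<Rightarrow> 'w) \<Rightarrow> ('w \<times> 'w \<Rightarrow>\<^sub>0 int) \<Rightarrow> ('w \<times> 'w \<Rightarrow>\<^sub>0 int)" where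
  "fmap2 f g u = frag_extend (\<lambda>(x, y). frag_of (f x, g y)) u"

definition fprod ::
  "('w::ring_1 \<times> 'w \<Rightarrow>\<^sub>0 int) \<Rightarrow> ('w \<times> 'w \<Rightarrow>\<^sub>0 int) \<Rightarrow> ('w \<times> 'w \<Rightarrow>\<^sub>0 int)" where
  "fprod u v =
    frag_extend (\<lambda>(x, y). frag_extend (\<lambda>(x', y'). frag_of (x * x', y * y')) v) u"

text \<open>The map \<open>f \<otimes> id\<close> between tensor products, with values in the tensor product of \<open>M\<close> and \<open>N\<close>.\<close>

definition tmap_left ::
  "'w::ring_1 set \<Rightarrow> 'w set \<Rightarrow> 'w set \<Rightarrow> ('w \<Rightarrow> 'w) \<Rightarrow>
   ('w \<times> 'w \<Rightarrow>\<^sub>0 int) set \<Rightarrow> ('w \<times> 'w \<Rightarrow>\<^sub>0 int) set" where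
  "tmap_left M R N f t = (THE t'. \<forall>u\<in>t. t' = tclass M R N (fmap2 f id u))"


section \<open>The exterior algebra over quantum SL(2)\<close>

datatype qform = EP | EM | E0

text \<open>The ambient ring \<open>'w\<close> is the whole exterior algebra; quantum SL(2) is its degree zero
  part and the wedge product is the ring multiplication. The field \<open>coact\<close> is the left coaction
  extending the coproduct.\<close>

record 'w qcalc =
  smult :: "complex \<Rightarrow> 'w \<Rightarrow> 'w" (infixr \<open>\<cdot>\<index>\<close> 75)
  gen :: "qgen \<Rightarrow> 'w"
  frm :: "qform \<Rightarrow> 'w"
  dif :: "'w \<Rightarrow> 'w"
  coact :: "'w \<Rightarrow> ('w \<times> 'w \<Rightarrow>\<^sub>0 int) set"

definition word_val :: "'w::ring_1 qcalc \<Rightarrow> qword \<Rightarrow> 'w" where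
  "word_val W w = prod_list (map (gen W) (letters w))"

definition poly_val :: "'w::ring_1 qcalc \<Rightarrow> (qword \<Rightarrow>\<^sub>0 complex) \<Rightarrow> 'w" where
  "poly_val W p =
    (\<Sum>w\<in>Poly_Mapping.keys p. Poly_Mapping.lookup p w \<cdot>\<^bsub>W\<^esub> word_val W w)"

definition qsl2 :: "'w::ring_1 qcalc \<Rightarrow> 'w set" where
  "qsl2 W = module.span (smult W) (range (word_val W))"

definition homog :: "'w::ring_1 qcalc \<Rightarrow> int \<Rightarrow> 'w set" where
  "homog W n = module.span (smult W) (word_val W ` {w. word_deg w = n})"

definition scalars :: "'w::ring_1 qcalc \<Rightarrow> 'w set" where
  "scalars W = range (\<lambda>z. z \<cdot>\<^bsub>W\<^esub> 1)"

primrec forms :: "'w::ring_1 qcalc \<Rightarrow> nat \<Rightarrow> 'w set" where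
  "forms W 0 = qsl2 W"
| "forms W (Suc k) = module.span (smult W) {\<omega> * frm W s |\<omega> s. \<omega> \<in> forms W k}"

definition ext_basis :: "'w::ring_1 qcalc \<Rightarrow> bool \<times> bool \<times> bool \<Rightarrow> 'w" where
  "ext_basis W = (\<lambda>(i, j, k).
     (if i then frm W EP else 1) * (if j then frm W EM else 1) * (if k then frm W E0 else 1))"

text \<open>The assumptions determine the structure up to isomorphism: \<open>presented\<close> says that \<open>qsl2 W\<close>
  is the algebra given by the generators and relations, and \<open>free\<close> that the exterior algebra is
  free as a left module over it on the eight ordered monomials in the invariant forms.\<close>

locale qsl2_calculus =
  fixes q :: complex and W :: "'w::ring_1 qcalc" (structure)
  assumes q_nonzero: "q \<noteq> 0"
    and smult_vector_space: "vector_space (smult W)"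
    and smult_mult_left: "z \<cdot> x * y = z \<cdot> (x * y)"
    and smult_mult_right: "x * z \<cdot> y = z \<cdot> (x * y)"
    and presented: "poly_val W p = 0 \<longleftrightarrow> p \<in> two_sided_ideal (qsl2_relations q)"
    and free: "\<exists>!x. range x \<subseteq> qsl2 W \<and> \<omega> = (\<Sum>s\<in>UNIV. x s * ext_basis W s)"
    and commute_ep: "x \<in> homog W n \<Longrightarrow> frm W EP * x = q powi n \<cdot> (x * frm W EP)"
    and commute_em: "x \<in> homog W n \<Longrightarrow> frm W EM * x = q powi n \<cdot> (x * frm W EM)"
    and commute_e0: "x \<in> homog W n \<Longrightarrow> frm W E0 * x = q powi (2 * n) \<cdot> (x * frm W E0)"
    and square_zero: "frm W s * frm W s = 0"
    and wedge_pm: "q\<^sup>2 \<cdot> (frm W EP * frm W EM) + frm W EM * frm W EP = 0"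
    and wedge_0p: "frm W E0 * frm W EP + q powi 4 \<cdot> (frm W EP * frm W E0) = 0"
    and wedge_0m: "frm W E0 * frm W EM + q powi (- 4) \<cdot> (frm W EM * frm W E0) = 0"
    and dif_add: "dif W (x + y) = dif W x + dif W y"
    and dif_smult: "dif W (z \<cdot> x) = z \<cdot> dif W x"
    and dif_leibniz: "x \<in> forms W k \<Longrightarrow> dif W (x * y) = dif W x * y + (- 1) ^ k * (x * dif W y)"
    and dif_dif: "dif W (dif W x) = 0"
    and dif_a: "dif W (gen W GA) = gen W GA * frm W E0 + q \<cdot> (gen W GB * frm W EP)"
    and dif_b: "dif W (gen W GB) = gen W GA * frm W EM - q powi (- 2) \<cdot> (gen W GB * frm W E0)"
    and dif_c: "dif W (gen W GC) = gen W GC * frm W E0 + q \<cdot> (gen W GD * frm W EP)"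
    and dif_d: "dif W (gen W GD) = gen W GC * frm W EM - q powi (- 2) \<cdot> (gen W GD * frm W E0)"
    and dif_e0: "dif W (frm W E0) = q ^ 3 \<cdot> (frm W EP * frm W EM)"
    and dif_ep: "dif W (frm W EP) =
      - ((q\<^sup>2 * (1 + q powi (- 2))) \<cdot> (frm W EP * frm W E0))"
    and dif_em: "dif W (frm W EM) =
      (q powi (- 2) * (1 + q powi (- 2))) \<cdot> (frm W EM * frm W E0)"
    and coact_tensor: "coact W x \<in> tensor (qsl2 W) (scalars W) UNIV"
    and coact_add: "u \<in> coact W x \<Longrightarrow> v \<in> coact W y \<Longrightarrow> u + v \<in> coact W (x + y)"
    and coact_mult: "u \<in> coact W x \<Longrightarrow> v \<in> coact W y \<Longrightarrow> fprod u v \<in> coact W (x * y)"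
    and coact_scalar: "frag_of (z \<cdot> 1, 1) \<in> coact W (z \<cdot> 1)"
    and coact_a: "frag_of (gen W GA, gen W GA) + frag_of (gen W GB, gen W GC) \<in> coact W (gen W GA)"
    and coact_b: "frag_of (gen W GA, gen W GB) + frag_of (gen W GB, gen W GD) \<in> coact W (gen W GB)"
    and coact_c: "frag_of (gen W GC, gen W GA) + frag_of (gen W GD, gen W GC) \<in> coact W (gen W GC)"
    and coact_d: "frag_of (gen W GC, gen W GB) + frag_of (gen W GD, gen W GD) \<in> coact W (gen W GD)"
    and coact_frm: "frag_of (1, frm W s) \<in> coact W (frm W s)"
    and coact_dif: "u \<in> coact W x \<Longrightarrow> fmap2 id (dif W) u \<in> coact W (dif W x)"


section \<open>The quantum sphere\<close>

inductive_set sphere_forms :: "'w::ring_1 qcalc \<Rightarrow> 'w set" for W where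
  base: "f \<in> homog W 0 \<Longrightarrow> f \<in> sphere_forms W"
| dif: "f \<in> homog W 0 \<Longrightarrow> dif W f \<in> sphere_forms W"
| add: "\<omega> \<in> sphere_forms W \<Longrightarrow> \<eta> \<in> sphere_forms W \<Longrightarrow> \<omega> + \<eta> \<in> sphere_forms W"
| mult: "\<omega> \<in> sphere_forms W \<Longrightarrow> \<eta> \<in> sphere_forms W \<Longrightarrow> \<omega> * \<eta> \<in> sphere_forms W"

definition sphere1 :: "'w::ring_1 qcalc \<Rightarrow> 'w set" where
  "sphere1 W = sphere_forms W \<inter> forms W 1"

definition forms10 :: "'w::ring_1 qcalc \<Rightarrow> 'w set" where
  "forms10 W = {f * frm W EP |f. f \<in> homog W (- 2)}"

definition forms01 :: "'w::ring_1 qcalc \<Rightarrow> 'w set" where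
  "forms01 W = {f * frm W EM |f. f \<in> homog W 2}"

definition proj10 :: "'w::ring_1 qcalc \<Rightarrow> 'w \<Rightarrow> 'w" where
  "proj10 W \<omega> = (THE \<alpha>. \<alpha> \<in> forms10 W \<and> (\<exists>\<beta>\<in>forms01 W. \<omega> = \<alpha> + \<beta>))"

definition proj01 :: "'w::ring_1 qcalc \<Rightarrow> 'w \<Rightarrow> 'w" where
  "proj01 W \<omega> = (THE \<beta>. \<beta> \<in> forms01 W \<and> (\<exists>\<alpha>\<in>forms10 W. \<omega> = \<alpha> + \<beta>))"

definition vol :: "'w::ring_1 qcalc \<Rightarrow> 'w" where
  "vol W = frm W EP * frm W EM"

definition hodge :: "'w::ring_1 qcalc \<Rightarrow> 'w \<Rightarrow> 'w" where
  "hodge W \<omega> = (THE \<eta>. \<exists>f\<in>homog W 0. \<exists>g\<in>homog W (- 2). \<exists>h\<in>homog W 2. \<exists>k\<in>homog W 0.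
     \<omega> = f + g * frm W EP + h * frm W EM + k * vol W \<and>
     \<eta> = f * vol W + g * frm W EP - h * frm W EM + k)"

definition laplacian :: "'w::ring_1 qcalc \<Rightarrow> 'w \<Rightarrow> 'w" where
  "laplacian W f = (- 1 / 2) \<cdot>\<^bsub>W\<^esub> hodge W (dif W (hodge W (dif W f)))"


section \<open>Spinors and the Dirac operator\<close>

text \<open>The value at \<open>p = 1\<close> is the limit, so that \<open>q = 1\<close> and \<open>q = - 1\<close> are covered.\<close>

definition q_int :: "complex \<Rightarrow> int \<Rightarrow> complex" where
  "q_int p n = (if p = 1 then of_int n else (1 - p powi n) / (1 - p))"

definition spinor_minus :: "'w::ring_1 qcalc \<Rightarrow> 'w set" where
  "spinor_minus W = homog W 1"

definition spinor_plus :: "'w::ring_1 qcalc \<Rightarrow> 'w set" where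
  "spinor_plus W = homog W (- 1)"

definition spinors :: "'w::ring_1 qcalc \<Rightarrow> 'w set" where
  "spinors W = {\<sigma> + \<tau> |\<sigma> \<tau>. \<sigma> \<in> spinor_minus W \<and> \<tau> \<in> spinor_plus W}"

definition is_cov_deriv ::
  "complex \<Rightarrow> 'w::ring_1 qcalc \<Rightarrow> int \<Rightarrow> 'w \<Rightarrow> ('w \<times> 'w \<Rightarrow>\<^sub>0 int) set \<Rightarrow> bool" where
  "is_cov_deriv q W n \<sigma> t \<longleftrightarrow>
     t \<in> tensor (sphere1 W) (homog W 0) (homog W n) \<and>
     tlift (*) t = dif W \<sigma> - q_int (q\<^sup>2) n \<cdot>\<^bsub>W\<^esub> (\<sigma> * frm W E0)"

definition cov_deriv ::
  "complex \<Rightarrow> 'w::ring_1 qcalc \<Rightarrow> int \<Rightarrow> 'w \<Rightarrow> ('w \<times> 'w \<Rightarrow>\<^sub>0 int) set" where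
  "cov_deriv q W n \<sigma> = (THE t. is_cov_deriv q W n \<sigma> t)"

definition cov_deriv10 ::
  "complex \<Rightarrow> 'w::ring_1 qcalc \<Rightarrow> int \<Rightarrow> 'w \<Rightarrow> ('w \<times> 'w \<Rightarrow>\<^sub>0 int) set" where
  "cov_deriv10 q W n \<sigma> =
     tmap_left (sphere1 W) (homog W 0) (homog W n) (proj10 W) (cov_deriv q W n \<sigma>)"

definition cov_deriv01 ::
  "complex \<Rightarrow> 'w::ring_1 qcalc \<Rightarrow> int \<Rightarrow> 'w \<Rightarrow> ('w \<times> 'w \<Rightarrow>\<^sub>0 int) set" where
  "cov_deriv01 q W n \<sigma> =
     tmap_left (sphere1 W) (homog W 0) (homog W n) (proj01 W) (cov_deriv q W n \<sigma>)"

definition clifford_pure :: "'w::ring_1 qcalc \<Rightarrow> 'w \<Rightarrow> 'w \<Rightarrow> 'w" where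
  "clifford_pure W \<omega> \<psi> = (THE y.
     \<exists>f\<in>homog W (- 2). \<exists>g\<in>homog W 2. \<exists>\<sigma>\<in>spinor_minus W. \<exists>\<tau>\<in>spinor_plus W.
       \<omega> = f * frm W EP + g * frm W EM \<and> \<psi> = \<sigma> + \<tau> \<and> y = f * \<sigma> + g * \<tau>)"

definition clifford :: "'w::ring_1 qcalc \<Rightarrow> ('w \<times> 'w \<Rightarrow>\<^sub>0 int) set \<Rightarrow> 'w" where
  "clifford W = tlift (clifford_pure W)"

definition dirac :: "complex \<Rightarrow> 'w::ring_1 qcalc \<Rightarrow> 'w \<Rightarrow> 'w" where
  "dirac q W \<psi> = (THE \<phi>. \<exists>\<sigma>\<in>spinor_minus W. \<exists>\<tau>\<in>spinor_plus W. \<psi> = \<sigma> + \<tau> \<and>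
     \<phi> = clifford W (cov_deriv q W 1 \<sigma>) + clifford W (cov_deriv q W (- 1) \<tau>))"

end

theory Submission
  imports Defs
begin

text \<open>Write \<open>d x = \<partial>\<^sub>+ x e\<^sup>+ + \<partial>\<^sub>- x e\<^sup>- + [n;q\<^sup>2] x e\<^sup>0\<close> for \<open>x\<close> of degree \<open>n\<close>; the
  \<open>e\<^sup>0\<close> term is exactly what the monopole connection removes. Since \<open>1\<close> is a combination of products
  of elements of degrees \<open>-n\<close> and \<open>n\<close>, an element of \<open>\<Omega>\<^sup>1 \<otimes> S\<close> is determined by its product, and moving
  \<open>e\<^sup>+\<close> or \<open>e\<^sup>-\<close> past a spinor shows that the Dirac operator is \<open>q\<^sup>-\<^sup>1 \<partial>\<^sub>+\<close> in degree \<open>1\<close> and \<open>q \<partial>\<^sub>-\<close> in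
  degree \<open>-1\<close>. Here \<open>\<partial>\<^sub>\<plusminus> x\<close> is the coefficient of \<open>e\<^sup>+ e\<^sup>- e\<^sup>0\<close> in the product of \<open>d x\<close> with an
  invariant form (up to a scalar), which gives covariance. The Laplacian is
  \<open>q\<^sup>2 \<partial>\<^sub>- \<partial>\<^sub>+ = \<partial>\<^sub>+ \<partial>\<^sub>-\<close>, so the twisted Leibniz rule for \<open>\<partial>\<^sub>\<plusminus>\<close> reduces the formulas to identities between monomials.\<close>

section \<open>Tensor products by formal sums\<close>

text \<open>The expression on which \<open>tlift\<close> requires all representatives of a tensor to
  agree, taken at one representative.\<close>

definition feval :: "('w \<Rightarrow> 'w \<Rightarrow> 'w::ring_1) \<Rightarrow> ('w \<times> 'w \<Rightarrow>\<^sub>0 int) \<Rightarrow> 'w" where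
  "feval h u =
     (\<Sum>k\<in>Poly_Mapping.keys u. of_int (Poly_Mapping.lookup u k) * h (fst k) (snd k))"

lemma feval_superset:
  assumes "finite K" "Poly_Mapping.keys u \<subseteq> K"
  shows "feval h u = (\<Sum>k\<in>K. of_int (Poly_Mapping.lookup u k) * h (fst k) (snd k))"
  unfolding feval_def
  by (rule sum.mono_neutral_left) (use assms in \<open>auto simp: in_keys_iff\<close>)

lemma feval_diff: "feval h (u - v) = feval h u - feval h v"
proof -
  let ?K = "Poly_Mapping.keys u \<union> Poly_Mapping.keys v"
  have "Poly_Mapping.keys (u - v) \<subseteq> ?K"
    by (rule keys_diff)
  then show ?thesis
    by (simp add: feval_superset[of ?K] lookup_minus left_diff_distrib sum_subtractf)
qed

lemma feval_zero [simp]: "feval h 0 = 0"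
  by (simp add: feval_def)

lemma feval_frag_of [simp]: "feval h (frag_of (x, y)) = h x y"
  by (simp add: feval_def)

lemma feval_add: "feval h (u + v) = feval h u + feval h v"
  using feval_diff[of h "u + v" v] by simp

lemma feval_sum: "feval h (\<Sum>k\<in>K. u k) = (\<Sum>k\<in>K. feval h (u k))"
  by (induction K rule: infinite_finite_induct) (simp_all add: feval_add)

section \<open>Maps and products on formal sums\<close>

lemma fmap2_frag_of [simp]: "fmap2 f g (frag_of (x, y)) = frag_of (f x, g y)"
  by (simp add: fmap2_def)

lemma fmap2_zero [simp]: "fmap2 f g 0 = 0"
  by (simp add: fmap2_def)

lemma fmap2_diff: "fmap2 f g (u - v) = fmap2 f g u - fmap2 f g v"
  by (simp add: fmap2_def frag_extend_diff)

lemma fmap2_add: "fmap2 f g (u + v) = fmap2 f g u + fmap2 f g v"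
  by (simp add: fmap2_def frag_extend_add)

lemma fmap2_cong:
  "(\<And>x y. (x, y) \<in> Poly_Mapping.keys u \<Longrightarrow> f x = f' x \<and> g y = g' y) \<Longrightarrow> fmap2 f g u = fmap2 f' g' u"
  unfolding fmap2_def by (rule frag_extend_eq) auto

lemma fmap2_ident: "fmap2 id id u = u"
  using subset_UNIV
  by (induction u rule: frag_induction) (auto simp: fmap2_diff)

lemma keys_fmap2: "Poly_Mapping.keys (fmap2 f g u) \<subseteq> map_prod f g ` Poly_Mapping.keys u"
  unfolding fmap2_def using keys_frag_extend by fastforce

lemma keys_fprod:
  "Poly_Mapping.keys (fprod u v) \<subseteq>
     {(x * x', y * y') |x y x' y'. (x, y) \<in> Poly_Mapping.keys u \<and> (x', y') \<in> Poly_Mapping.keys v}"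
proof
  fix z assume "z \<in> Poly_Mapping.keys (fprod u v)"
  then obtain x y where xy: "(x, y) \<in> Poly_Mapping.keys u"
    and "z \<in> Poly_Mapping.keys (frag_extend (\<lambda>(x', y'). frag_of (x * x', y * y')) v)"
    unfolding fprod_def using keys_frag_extend by fastforce
  then obtain x' y' where "(x', y') \<in> Poly_Mapping.keys v"
    and "z \<in> Poly_Mapping.keys (frag_of (x * x', y * y'))"
    using keys_frag_extend by fastforce
  with xy show "z \<in> {(x * x', y * y') |x y x' y'.
      (x, y) \<in> Poly_Mapping.keys u \<and> (x', y') \<in> Poly_Mapping.keys v}"
    by auto
qed

text \<open>Multiplying by \<open>frag_of (1, e)\<close> touches right factors only.
  Differentiating, multiplying by an invariant form and extracting a coefficient thus fuse into one
  map on right factors.\<close>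

lemma fmap2_fprod_frag_of:
  "fmap2 f g (fprod (fmap2 id k u) (frag_of (1, e))) = fmap2 f (\<lambda>y. g (k y * e)) u"
  using subset_UNIV
proof (induction u rule: frag_induction)
  case (diff u v)
  then show ?case by (simp add: fmap2_diff fprod_def frag_extend_diff)
qed (auto simp: fprod_def)

section \<open>Tensors as cosets of the null relations, and maps induced on them\<close>

lemma tnull_uminus: "u \<in> tnull M R N \<Longrightarrow> - u \<in> tnull M R N"
  using tnull.diff[OF tnull.zero] by fastforce

lemma tnull_plus: "u \<in> tnull M R N \<Longrightarrow> v \<in> tnull M R N \<Longrightarrow> u + v \<in> tnull M R N"
  using tnull.diff[OF _ tnull_uminus] by fastforce

lemma tclass_eqI:
  assumes "u - v \<in> tnull M R N"
  shows "tclass M R N u = tclass M R N v"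
proof -
  have "w - v \<in> tnull M R N \<longleftrightarrow> w - u \<in> tnull M R N" for w
    using tnull_plus[of "w - u" M R N "u - v"] tnull.diff[of "w - v" M R N "u - v"] assms by auto
  then show ?thesis by (auto simp: tclass_def)
qed

lemma tclass_self: "Poly_Mapping.keys u \<subseteq> M \<times> N \<Longrightarrow> u \<in> tclass M R N u"
  by (simp add: tclass_def tnull.zero)

lemma tensor_memD:
  assumes "t \<in> tensor M R N" "u \<in> t"
  shows "t = tclass M R N u" "Poly_Mapping.keys u \<subseteq> M \<times> N"
proof -
  obtain u0 where t: "t = tclass M R N u0" using assms(1) by (auto simp: tensor_def)
  with assms(2) show "t = tclass M R N u" "Poly_Mapping.keys u \<subseteq> M \<times> N"
    using tclass_eqI[of u u0] by (auto simp: tclass_def)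
qed

lemma tensor_mem_iff:
  assumes "t \<in> tensor M R N" "u \<in> t"
  shows "v \<in> t \<longleftrightarrow> Poly_Mapping.keys v \<subseteq> M \<times> N \<and> v - u \<in> tnull M R N"
  using tensor_memD(1)[OF assms] by (simp add: tclass_def)

lemma feval_tnull:
  assumes "\<And>m m' n. m \<in> M \<Longrightarrow> m' \<in> M \<Longrightarrow> n \<in> N \<Longrightarrow> h (m + m') n = h m n + h m' n"
    and "\<And>m n n'. m \<in> M \<Longrightarrow> n \<in> N \<Longrightarrow> n' \<in> N \<Longrightarrow> h m (n + n') = h m n + h m n'"
    and "\<And>m r n. m \<in> M \<Longrightarrow> r \<in> R \<Longrightarrow> n \<in> N \<Longrightarrow> h (m * r) n = h m (r * n)"
    and "u \<in> tnull M R N"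
  shows "feval h u = 0"
  using assms(4) by induction (simp_all add: feval_diff assms(1-3))

lemma tlift_tclass:
  assumes "\<And>m m' n. m \<in> M \<Longrightarrow> m' \<in> M \<Longrightarrow> n \<in> N \<Longrightarrow> h (m + m') n = h m n + h m' n"
    and "\<And>m n n'. m \<in> M \<Longrightarrow> n \<in> N \<Longrightarrow> n' \<in> N \<Longrightarrow> h m (n + n') = h m n + h m n'"
    and "\<And>m r n. m \<in> M \<Longrightarrow> r \<in> R \<Longrightarrow> n \<in> N \<Longrightarrow> h (m * r) n = h m (r * n)"
    and "Poly_Mapping.keys u \<subseteq> M \<times> N"
  shows "tlift h (tclass M R N u) = feval h u"
proof -
  have eq: "feval h v = feval h u" if "v \<in> tclass M R N u" for v
  proof -
    have "feval h (v - u) = 0"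
      using that by (intro feval_tnull[OF assms(1-3)]) (auto simp: tclass_def)
    then show ?thesis by (simp add: feval_diff)
  qed
  \<comment> \<open>The class contains \<open>u\<close>, so the description in \<open>tlift\<close>
    has a unique solution; over an empty class every value would satisfy it.\<close>
  show ?thesis
    unfolding tlift_def feval_def[symmetric]
    using eq tclass_self[OF assms(4)] by (intro the_equality ballI) (metis, blast)
qed

lemma tlift_times_tclass:
  "Poly_Mapping.keys u \<subseteq> M \<times> N \<Longrightarrow> tlift (*) (tclass M R N u) = feval (*) u"
  by (rule tlift_tclass) (simp_all add: algebra_simps)

lemma fmap2_left_tnull:
  assumes f: "\<And>m. m \<in> M \<Longrightarrow> f m \<in> M"
    and add: "\<And>m m'. m \<in> M \<Longrightarrow> m' \<in> M \<Longrightarrow> f (m + m') = f m + f m'"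
    and mult: "\<And>m r. m \<in> M \<Longrightarrow> r \<in> R \<Longrightarrow> f (m * r) = f m * r"
    and "u \<in> tnull M R N"
  shows "fmap2 f id u \<in> tnull M R N"
  using assms(4) by induction (auto simp: fmap2_diff add mult f intro: tnull.intros)

lemma tmap_left_tclass:
  assumes f: "\<And>m. m \<in> M \<Longrightarrow> f m \<in> M"
    and add: "\<And>m m'. m \<in> M \<Longrightarrow> m' \<in> M \<Longrightarrow> f (m + m') = f m + f m'"
    and mult: "\<And>m r. m \<in> M \<Longrightarrow> r \<in> R \<Longrightarrow> f (m * r) = f m * r"
    and u: "Poly_Mapping.keys u \<subseteq> M \<times> N"
  shows "tmap_left M R N f (tclass M R N u) = tclass M R N (fmap2 f id u)"
proof -
  have eq: "tclass M R N (fmap2 f id v) = tclass M R N (fmap2 f id u)" if "v \<in> tclass M R N u" for v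
  proof (rule tclass_eqI)
    show "fmap2 f id v - fmap2 f id u \<in> tnull M R N"
      using that fmap2_left_tnull[of M f R "v - u" N] f add mult
      by (auto simp: tclass_def fmap2_diff)
  qed
  show ?thesis
    unfolding tmap_left_def
    using eq tclass_self[OF u] by (intro the_equality ballI) (metis, blast)
qed

text \<open>With \<open>1 = \<Sum> v k * u k\<close> where \<open>N * v k \<subseteq> R\<close>, a tensor
  \<open>m \<otimes> n = m \<otimes> n (\<Sum> v k * u k)\<close> equals \<open>\<Sum> m n v k \<otimes> u k\<close> and hence is determined by \<open>m n\<close>.\<close>

lemma tclass_normal_form:
  fixes v u :: "'k \<Rightarrow> 'w::ring_1"
  assumes fin: "finite K" and unit: "(\<Sum>k\<in>K. v k * u k) = 1"
    and N0: "0 \<in> N" and Nadd: "\<And>n n'. n \<in> N \<Longrightarrow> n' \<in> N \<Longrightarrow> n + n' \<in> N"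
    and RN: "\<And>r n. r \<in> R \<Longrightarrow> n \<in> N \<Longrightarrow> r * n \<in> N"
    and u: "\<And>k. k \<in> K \<Longrightarrow> u k \<in> N"
    and nv: "\<And>n k. n \<in> N \<Longrightarrow> k \<in> K \<Longrightarrow> n * v k \<in> R"
    and M0: "0 \<in> M" and Mdiff: "\<And>m m'. m \<in> M \<Longrightarrow> m' \<in> M \<Longrightarrow> m - m' \<in> M"
    and MR: "\<And>m r. m \<in> M \<Longrightarrow> r \<in> R \<Longrightarrow> m * r \<in> M"
    and keys: "Poly_Mapping.keys s \<subseteq> M \<times> N"
  shows "tclass M R N s = tclass M R N (\<Sum>k\<in>K. frag_of (feval (*) s * v k, u k))"
proof -
  let ?nf = "\<lambda>x. \<Sum>k\<in>K. frag_of (x * v k, u k)"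
  \<comment> \<open>The left additivity relation at \<open>m = m' = 0\<close> is
    \<open>- frag_of (0, n)\<close>.\<close>
  have zero_left: "frag_of (0, n) \<in> tnull M R N" if "n \<in> N" for n
    using tnull_uminus[OF tnull.add_left[OF M0 M0 that]] by simp
  have split: "frag_of (m, \<Sum>k\<in>L. w k) - (\<Sum>k\<in>L. frag_of (m, w k)) \<in> tnull M R N \<and> (\<Sum>k\<in>L. w k) \<in> N"
    if "m \<in> M" "finite L" "\<And>k. k \<in> L \<Longrightarrow> w k \<in> N" for m L and w :: "'k \<Rightarrow> 'w"
    using that(2,3)
  proof (induction L)
    case empty
    show ?case using tnull_uminus[OF tnull.add_right[OF that(1) N0 N0]] N0 by simp
  next
    case (insert k L)
    then have IH: "frag_of (m, \<Sum>k\<in>L. w k) - (\<Sum>k\<in>L. frag_of (m, w k)) \<in> tnull M R N"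
      and mem: "(\<Sum>k\<in>L. w k) \<in> N" "w k \<in> N" by auto
    show ?case
      using tnull_plus[OF tnull.add_right[OF that(1) mem(2,1)] IH] insert(1,2) Nadd mem
      by (simp add: algebra_simps)
  qed
  have sum_mem: "(\<Sum>k\<in>L. w k) \<in> tnull M R N" if "\<And>k. k \<in> L \<Longrightarrow> w k \<in> tnull M R N" for L :: "'k set" and w
    using that by (induction L rule: infinite_finite_induct) (auto intro: tnull.zero tnull_plus)
  \<comment> \<open>Membership in \<open>M\<close> is carried through the induction because the
    difference case applies left additivity to these products.\<close>
  have "(\<forall>k\<in>K. feval (*) s * v k \<in> M) \<and> s - ?nf (feval (*) s) \<in> tnull M R N"
    using keys
  proof (induction s rule: frag_induction)
    case zero
    have "?nf 0 \<in> tnull M R N"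
      by (rule sum_mem) (simp add: zero_left u)
    then show ?case using tnull_uminus M0 by fastforce
  next
    case (one x)
    then obtain m n where x: "x = (m, n)" and m: "m \<in> M" and n: "n \<in> N" by auto
    have eq: "(\<Sum>k\<in>K. (n * v k) * u k) = n"
      using unit by (simp add: mult.assoc flip: sum_distrib_left)
    have "frag_of (m, n) - (\<Sum>k\<in>K. frag_of (m, (n * v k) * u k)) \<in> tnull M R N"
      using split[OF m fin, of "\<lambda>k. (n * v k) * u k"] RN nv n u eq by simp
    moreover have "(\<Sum>k\<in>K. frag_of (m * (n * v k), u k) - frag_of (m, (n * v k) * u k)) \<in> tnull M R N"
      by (rule sum_mem) (use m n u nv in \<open>auto intro: tnull.balanced\<close>)
    ultimately have "frag_of (m, n) - ?nf (m * n) \<in> tnull M R N"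
      using tnull.diff by (fastforce simp: sum_subtractf mult.assoc)
    then show ?case using x m n nv MR by (simp add: mult.assoc)
  next
    case (diff s t)
    let ?x = "feval (*) s" and ?y = "feval (*) t"
    \<comment> \<open>The normal form is additive in the product only modulo \<open>tnull\<close>;
      this is the defect of one summand.\<close>
    have "frag_of (?x * v k, u k) - frag_of ((?x - ?y) * v k, u k) - frag_of (?y * v k, u k)
        \<in> tnull M R N" if "k \<in> K" for k
      using tnull.add_left[of "(?x - ?y) * v k" M "?y * v k" "u k" N R] that diff Mdiff u
      by (simp add: left_diff_distrib)
    from sum_mem[OF this]
    have "?nf ?x - ?nf (?x - ?y) - ?nf ?y \<in> tnull M R N"
      by (simp add: sum_subtractf)
    moreover have "(s - ?nf ?x) - (t - ?nf ?y) \<in> tnull M R N"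
      using diff by (auto intro: tnull.diff)
    ultimately have "(s - ?nf ?x) - (t - ?nf ?y) + (?nf ?x - ?nf (?x - ?y) - ?nf ?y) \<in> tnull M R N"
      by (rule tnull_plus[rotated])
    also have "(s - ?nf ?x) - (t - ?nf ?y) + (?nf ?x - ?nf (?x - ?y) - ?nf ?y)
        = (s - t) - ?nf (?x - ?y)"
      by (simp add: algebra_simps)
    finally show ?case
      using diff Mdiff by (auto simp: feval_diff left_diff_distrib)
  qed
  then show ?thesis
    by (intro tclass_eqI) blast
qed

section \<open>The grading\<close>

definition deg_part :: "int \<Rightarrow> (qword \<Rightarrow>\<^sub>0 complex) \<Rightarrow> (qword \<Rightarrow>\<^sub>0 complex)" where
  "deg_part n p = Poly_Mapping.mapp (\<lambda>w z. if word_deg w = n then z else 0) p"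

lemma lookup_deg_part:
  "Poly_Mapping.lookup (deg_part n p) w = (if word_deg w = n then Poly_Mapping.lookup p w else 0)"
  by (auto simp: deg_part_def lookup_mapp when_def in_keys_iff)

lemma deg_part_zero [simp]: "deg_part n 0 = 0"
  by (rule poly_mapping_eqI) (simp add: lookup_deg_part)

lemma deg_part_add: "deg_part n (p + r) = deg_part n p + deg_part n r"
  by (rule poly_mapping_eqI) (simp add: lookup_deg_part lookup_add)

lemma deg_part_diff: "deg_part n (p - r) = deg_part n p - deg_part n r"
  by (rule poly_mapping_eqI) (simp add: lookup_deg_part lookup_minus)

lemma deg_part_homogeneous:
  assumes "Poly_Mapping.keys p \<subseteq> {w. word_deg w = m}"
  shows "deg_part n p = (if m = n then p else 0)"
  by (rule poly_mapping_eqI) (use assms in \<open>auto simp: lookup_deg_part in_keys_iff\<close>)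

lemma word_deg_plus: "word_deg (v + w) = word_deg v + word_deg w"
  by (simp add: word_deg_def plus_qword_def)

lemma word_deg_zero [simp]: "word_deg 0 = 0"
  by (simp add: word_deg_def zero_qword_def)

lemma homogeneous_mult:
  assumes "Poly_Mapping.keys p \<subseteq> {w. word_deg w = m}" "Poly_Mapping.keys r \<subseteq> {w. word_deg w = n}"
  shows "Poly_Mapping.keys (p * r) \<subseteq> {w. word_deg w = m + n}"
  using assms keys_mult[of p r] by (fastforce simp: word_deg_plus)

lemma homogeneous_single:
  "Poly_Mapping.keys (Poly_Mapping.single w z) \<subseteq> {v. word_deg v = word_deg w}"
  by simp

lemma poly_eq_sum_single: "p = (\<Sum>w\<in>Poly_Mapping.keys p. Poly_Mapping.single w (Poly_Mapping.lookup p w))"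
  by (rule poly_mapping_eqI) (auto simp: lookup_sum lookup_single when_def in_keys_iff)

lemma two_sided_ideal_sum:
  "(\<And>k. k \<in> K \<Longrightarrow> p k \<in> two_sided_ideal R) \<Longrightarrow> (\<Sum>k\<in>K. p k) \<in> two_sided_ideal R"
  by (induction K rule: infinite_finite_induct) (auto intro: two_sided_ideal.intros)

lemma deg_part_sum: "deg_part n (\<Sum>k\<in>K. p k) = (\<Sum>k\<in>K. deg_part n (p k))"
  by (induction K rule: infinite_finite_induct) (auto simp: deg_part_add)

text \<open>Five relations compare two monomials of equal degree; the two determinant relations
  involve \<open>1\<close> and monomials of degree zero.\<close>

lemma qsl2_relations_homogeneous:
  assumes "r \<in> qsl2_relations q"
  shows "\<exists>m. Poly_Mapping.keys r \<subseteq> {w. word_deg w = m}"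
proof -
  have two: "\<exists>m. Poly_Mapping.keys (Poly_Mapping.single v z - Poly_Mapping.single w z') \<subseteq> {w. word_deg w = m}"
    if "word_deg v = word_deg w" for v w and z z' :: complex
    using keys_diff[of "Poly_Mapping.single v z" "Poly_Mapping.single w z'"] that
    by (intro exI[of _ "word_deg v"]) (auto split: if_splits)
  have three: "\<exists>m. Poly_Mapping.keys (Poly_Mapping.single v z - 1 - Poly_Mapping.single w z') \<subseteq> {w. word_deg w = m}"
    if "word_deg v = 0" "word_deg w = 0" for v w and z z' :: complex
    using keys_diff[of "Poly_Mapping.single v z - 1" "Poly_Mapping.single w z'"]
      keys_diff[of "Poly_Mapping.single v z" 1] that
    by (intro exI[of _ 0]) (auto split: if_splits)
  show ?thesis
    using assms unfolding qsl2_relations_def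
    by (elim insertE emptyE; simp only: mult_single plus_qword_def zero_qword_def qword.sel
          append.simps mult_1_left mult_1_right)
       (rule two three; simp add: word_deg_def)+
qed

text \<open>A homogeneous relation between two monomials stays homogeneous, so its degree part is
  the whole product or zero. General cofactors are finite sums of monomials.\<close>

lemma deg_part_ideal:
  assumes "p \<in> two_sided_ideal (qsl2_relations q)"
  shows "deg_part n p \<in> two_sided_ideal (qsl2_relations q)"
  using assms
proof induction
  case zero
  show ?case by (simp add: two_sided_ideal.zero)
next
  case (gen r x y)
  obtain m where r: "Poly_Mapping.keys r \<subseteq> {w. word_deg w = m}"
    using qsl2_relations_homogeneous[OF gen] by blast
  have mono: "deg_part n (Poly_Mapping.single v z * r * Poly_Mapping.single w z')
      \<in> two_sided_ideal (qsl2_relations q)" for v w z z'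
  proof -
    have "Poly_Mapping.keys (Poly_Mapping.single v z * r * Poly_Mapping.single w z')
        \<subseteq> {u. word_deg u = word_deg v + m + word_deg w}"
      by (intro homogeneous_mult homogeneous_single r)
    then show ?thesis
      using gen by (auto simp: deg_part_homogeneous intro: two_sided_ideal.intros)
  qed
  let ?s = "\<lambda>p w. Poly_Mapping.single w (Poly_Mapping.lookup p w)"
  have "x * r * y = (\<Sum>v\<in>Poly_Mapping.keys x. \<Sum>w\<in>Poly_Mapping.keys y. ?s x v * r * ?s y w)"
    by (subst poly_eq_sum_single[of x], subst poly_eq_sum_single[of y])
      (simp add: sum_distrib_left sum_distrib_right, rule sum.swap)
  then show ?case
    by (simp only: deg_part_sum) (intro two_sided_ideal_sum mono)
next
  case (add x y)
  then show ?case by (simp add: deg_part_add two_sided_ideal.add)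
qed

section \<open>Arithmetic of q-integers\<close>

lemma q_int_zero [simp]: "q_int p 0 = 0"
  by (simp add: q_int_def)

lemma q_int_one [simp]: "q_int p 1 = 1"
  by (simp add: q_int_def)

lemma q_int_minus_one: "p \<noteq> 0 \<Longrightarrow> q_int p (- 1) = - inverse p"
  by (simp add: q_int_def field_simps)

text \<open>At \<open>p = q\<^sup>2\<close> this is what keeps the \<open>e0\<close> component of
  the differential consistent under products: moving \<open>e0\<close> past degree \<open>n\<close>
  costs the factor \<open>p powi n\<close>.\<close>

lemma q_int_add: "p \<noteq> 0 \<Longrightarrow> q_int p (m + n) = p powi n * q_int p m + q_int p n"
  by (simp add: q_int_def power_int_add field_simps add_divide_distrib[symmetric])

section \<open>The algebra and its calculus\<close>

context qsl2_calculus
begin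

sublocale vs: vector_space "smult W"
  by (rule smult_vector_space)

abbreviation "ga \<equiv> gen W GA"
abbreviation "gb \<equiv> gen W GB"
abbreviation "gc \<equiv> gen W GC"
abbreviation "gd \<equiv> gen W GD"
abbreviation "ep \<equiv> frm W EP"
abbreviation "em \<equiv> frm W EM"
abbreviation "e0 \<equiv> frm W E0"

lemmas scale_simps = smult_mult_left smult_mult_right vs.scale_scale vs.scale_right_distrib
  vs.scale_right_diff_distrib

section \<open>Evaluation of noncommutative polynomials\<close>

lemma poly_val_superset:
  assumes "finite K" "Poly_Mapping.keys p \<subseteq> K"
  shows "poly_val W p = (\<Sum>w\<in>K. Poly_Mapping.lookup p w \<cdot> word_val W w)"
  unfolding poly_val_def
  by (rule sum.mono_neutral_left) (use assms in \<open>auto simp: in_keys_iff\<close>)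

lemma poly_val_diff: "poly_val W (p - r) = poly_val W p - poly_val W r"
proof -
  let ?K = "Poly_Mapping.keys p \<union> Poly_Mapping.keys r"
  have "Poly_Mapping.keys (p - r) \<subseteq> ?K"
    by (rule keys_diff)
  then show ?thesis
    by (simp add: poly_val_superset[of ?K] lookup_minus vs.scale_left_diff_distrib sum_subtractf)
qed

lemma poly_val_add: "poly_val W (p + r) = poly_val W p + poly_val W r"
  using poly_val_diff[of "p + r" r] by simp

lemma poly_val_zero [simp]: "poly_val W 0 = 0"
  by (simp add: poly_val_def)

lemma poly_val_single [simp]: "poly_val W (Poly_Mapping.single w z) = z \<cdot> word_val W w"
  by (simp add: poly_val_superset[of "{w}"])

lemma word_val_plus: "word_val W (v + w) = word_val W v * word_val W w"
  by (simp add: word_val_def plus_qword_def)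

lemma word_val_zero [simp]: "word_val W 0 = 1"
  by (simp add: word_val_def zero_qword_def)

lemma relation_val: "r \<in> qsl2_relations q \<Longrightarrow> poly_val W r = 0"
  using two_sided_ideal.gen[of r "qsl2_relations q" 1 1] by (simp add: presented)

lemma poly_val_one [simp]: "poly_val W 1 = 1"
  using poly_val_single[of 0 1] by (simp del: poly_val_single)

lemma gen_relations:
  "gb * ga = q \<cdot> (ga * gb)" "gc * ga = q \<cdot> (ga * gc)"
  "gd * gb = q \<cdot> (gb * gd)" "gd * gc = q \<cdot> (gc * gd)" "gc * gb = gb * gc"
  "ga * gd = 1 + inverse q \<cdot> (gb * gc)" "gd * ga = 1 + q \<cdot> (gb * gc)"
  using relation_val[of "qvar GB * qvar GA - qconst q * qvar GA * qvar GB"]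
    relation_val[of "qvar GC * qvar GA - qconst q * qvar GA * qvar GC"]
    relation_val[of "qvar GD * qvar GB - qconst q * qvar GB * qvar GD"]
    relation_val[of "qvar GD * qvar GC - qconst q * qvar GC * qvar GD"]
    relation_val[of "qvar GB * qvar GC - qvar GC * qvar GB"]
    relation_val[of "qvar GA * qvar GD - 1 - qconst (inverse q) * qvar GB * qvar GC"]
    relation_val[of "qvar GD * qvar GA - 1 - qconst q * qvar GB * qvar GC"]
  unfolding qsl2_relations_def
  by (simp_all add: mult_single poly_val_diff word_val_def plus_qword_def zero_qword_def
      diff_eq_eq eq_diff_eq add.commute)

section \<open>The graded components\<close>

lemma homog_zero [simp]: "0 \<in> homog W n"
  and homog_add: "x \<in> homog W n \<Longrightarrow> y \<in> homog W n \<Longrightarrow> x + y \<in> homog W n"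
  and homog_diff: "x \<in> homog W n \<Longrightarrow> y \<in> homog W n \<Longrightarrow> x - y \<in> homog W n"
  and homog_smult: "x \<in> homog W n \<Longrightarrow> z \<cdot> x \<in> homog W n"
  and homog_uminus: "x \<in> homog W n \<Longrightarrow> - x \<in> homog W n"
  by (simp_all add: homog_def vs.span_zero vs.span_add vs.span_diff vs.span_scale vs.span_neg)

lemma homog_word: "word_val W w \<in> homog W (word_deg w)"
  unfolding homog_def by (rule vs.span_base) simp

lemma homog_induct [consumes 1, case_names zero add]:
  assumes "x \<in> homog W n" and "P 0"
    and "\<And>z w x. word_deg w = n \<Longrightarrow> x \<in> homog W n \<Longrightarrow> P x \<Longrightarrow> P (z \<cdot> word_val W w + x)"
  shows "P x"
proof -
  \<comment> \<open>Membership is proved together with \<open>P\<close>, since the third assumption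
    asks for it on the partial sum.\<close>
  have "x \<in> homog W n \<and> P x"
    using assms(1)[unfolded homog_def]
  proof (induction rule: vs.span_induct_alt)
    case base
    then show ?case by (simp add: assms(2))
  next
    case (step z y x)
    then show ?case
      using homog_word by (auto intro!: assms(3) homog_add homog_smult)
  qed
  then show ?thesis ..
qed

lemma homog_mult:
  assumes x: "x \<in> homog W m" and y: "y \<in> homog W n"
  shows "x * y \<in> homog W (m + n)"
  using x
proof (induction rule: homog_induct)
  case zero
  show ?case by simp
next
  case (add z v x)
  have "word_val W v * y \<in> homog W (m + n)"
    using y
  proof (induction rule: homog_induct)
    case zero
    show ?case by simp
  next
    case (add z' w y)
    have "word_val W v * word_val W w \<in> homog W (m + n)"
      using homog_word[of "v + w"] add \<open>word_deg v = m\<close> by (simp add: word_val_plus word_deg_plus)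
    with add show ?case by (simp add: distrib_left smult_mult_right homog_add homog_smult)
  qed
  with add show ?case by (simp add: distrib_right smult_mult_left homog_add homog_smult)
qed

lemma homog_mult': "x \<in> homog W m \<Longrightarrow> y \<in> homog W n \<Longrightarrow> m + n = k \<Longrightarrow> x * y \<in> homog W k"
  using homog_mult by blast

lemma homog_gen: "gen W g \<in> homog W (gen_deg g)"
  using homog_word[of "QWord [g]"] by (simp add: word_val_def word_deg_def)

lemma homog_one: "1 \<in> homog W 0"
  using homog_word[of 0] by simp

lemma homog_gens: "ga \<in> homog W 1" "gb \<in> homog W (- 1)" "gc \<in> homog W 1" "gd \<in> homog W (- 1)"
  using homog_gen[of GA] homog_gen[of GB] homog_gen[of GC] homog_gen[of GD] by simp_all

lemma homog_subset_qsl2: "homog W n \<subseteq> qsl2 W"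
  unfolding homog_def qsl2_def by (rule vs.span_mono) blast

lemma qsl2_subspace: "vs.subspace (qsl2 W)"
  unfolding qsl2_def by (rule vs.subspace_span)

text \<open>Lifts homogeneous elements to the free algebra, where degree parts can be taken.\<close>

lemma homog_poly: "x \<in> homog W n \<Longrightarrow> \<exists>p. Poly_Mapping.keys p \<subseteq> {w. word_deg w = n} \<and> x = poly_val W p"
proof (induction rule: homog_induct)
  case zero
  show ?case by (intro exI[of _ 0]) simp
next
  case (add z w x)
  then obtain p where p: "Poly_Mapping.keys p \<subseteq> {w. word_deg w = n}" "x = poly_val W p" by auto
  show ?case
    using p add keys_add[of "Poly_Mapping.single w z" p]
    by (intro exI[of _ "Poly_Mapping.single w z + p"]) (auto simp: poly_val_add split: if_splits)
qed

text \<open>The relations are homogeneous, so the ideal they generate contains the homogeneous parts of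
  its elements.\<close>

lemma homog_disjoint:
  assumes "x \<in> homog W m" "x \<in> homog W n" "m \<noteq> n"
  shows "x = 0"
proof -
  obtain p r where p: "Poly_Mapping.keys p \<subseteq> {w. word_deg w = m}" "x = poly_val W p"
    and r: "Poly_Mapping.keys r \<subseteq> {w. word_deg w = n}" "x = poly_val W r"
    using homog_poly assms by metis
  have "p - r \<in> two_sided_ideal (qsl2_relations q)"
    using p r by (simp add: poly_val_diff flip: presented)
  then have "deg_part m (p - r) \<in> two_sided_ideal (qsl2_relations q)"
    by (rule deg_part_ideal)
  \<comment> \<open>\<open>r\<close> has no part of degree \<open>m\<close>, so \<open>p\<close>
    alone lies in the ideal.\<close>
  moreover have "deg_part m (p - r) = p"
    using assms(3) deg_part_homogeneous[OF p(1), of m] deg_part_homogeneous[OF r(1), of m]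
    by (simp add: deg_part_diff)
  ultimately show ?thesis
    using p(2) presented by simp
qed

section \<open>Freeness of the exterior algebra and commutation of invariant forms\<close>

lemma ext_coeff_unique:
  assumes x: "range x \<subseteq> qsl2 W" and y: "range y \<subseteq> qsl2 W"
    and eq: "(\<Sum>s\<in>UNIV. x s * ext_basis W s) = (\<Sum>s\<in>UNIV. y s * ext_basis W s)"
  shows "x = y"
  using free[of "\<Sum>s\<in>UNIV. x s * ext_basis W s"] assms by blast

lemma ext_unique:
  assumes "f \<in> qsl2 W" "g \<in> qsl2 W" "h \<in> qsl2 W" "k \<in> qsl2 W" "l \<in> qsl2 W" "t \<in> qsl2 W"
    and "f' \<in> qsl2 W" "g' \<in> qsl2 W" "h' \<in> qsl2 W" "k' \<in> qsl2 W" "l' \<in> qsl2 W" "t' \<in> qsl2 W"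
    and eq: "f + g * ep + h * em + k * (ep * em) + l * e0 + t * (ep * em * e0) =
      f' + g' * ep + h' * em + k' * (ep * em) + l' * e0 + t' * (ep * em * e0)"
  shows "f = f' \<and> g = g' \<and> h = h' \<and> k = k' \<and> l = l' \<and> t = t'"
proof -
  \<comment> \<open>The remaining two basis monomials, \<open>ep * e0\<close> and
    \<open>em * e0\<close>, get coefficient zero.\<close>
  let ?x = "\<lambda>f g h k l t (i, j, m). if i then if j then if m then t else k else if m then 0 else g
    else if j then if m then 0 else h else if m then l else f"
  have univ: "(UNIV :: (bool \<times> bool \<times> bool) set) = UNIV \<times> UNIV \<times> UNIV" by simp
  have sum: "(\<Sum>s\<in>UNIV. ?x f g h k l t s * ext_basis W s)
      = f + g * ep + h * em + k * (ep * em) + l * e0 + t * (ep * em * e0)" for f g h k l t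
    unfolding univ UNIV_bool by (simp add: sum.cartesian_product[symmetric] ext_basis_def algebra_simps)
  have ran: "range (?x f g h k l t) \<subseteq> qsl2 W"
    if "f \<in> qsl2 W" "g \<in> qsl2 W" "h \<in> qsl2 W" "k \<in> qsl2 W" "l \<in> qsl2 W" "t \<in> qsl2 W" for f g h k l t
    using that vs.subspace_0[OF qsl2_subspace] by auto
  have "?x f g h k l t = ?x f' g' h' k' l' t'"
    using ran[OF assms(1-6)] ran[OF assms(7-12)] eq unfolding sum[symmetric]
    by (rule ext_coeff_unique)
  then have eq: "?x f g h k l t s = ?x f' g' h' k' l' t' s" for s
    by (rule fun_cong)
  show ?thesis
    using eq[of "(False, False, False)"] eq[of "(True, False, False)"] eq[of "(False, True, False)"]
      eq[of "(True, True, False)"] eq[of "(False, False, True)"] eq[of "(True, True, True)"]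
    by simp
qed

lemma frm_commute:
  assumes "x \<in> homog W n"
  shows "ep * x = q powi n \<cdot> (x * ep)" "em * x = q powi n \<cdot> (x * em)"
    "e0 * x = q powi (2 * n) \<cdot> (x * e0)"
  using assms commute_ep commute_em commute_e0 by blast+

text \<open>Makes a rule for a product of two letters applicable inside a word that is nested to the
  right by \<open>mult.assoc\<close>.\<close>

lemma mult_left_assoc_eq:
  "s * s' = r \<Longrightarrow> s * (s' * y) = r * y" for s s' r y :: 'w
  by (simp flip: mult.assoc)

lemma wedge: "em * ep = - (q\<^sup>2 \<cdot> (ep * em))" "e0 * ep = - (q powi 4 \<cdot> (ep * e0))"
    "e0 * em = - (q powi (- 4) \<cdot> (em * e0))"
  using wedge_pm wedge_0p wedge_0m by (simp_all add: add_eq_0_iff)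

lemmas wedge_rules = wedge square_zero wedge[THEN mult_left_assoc_eq] square_zero[THEN mult_left_assoc_eq]

text \<open>A linear left inverse of multiplication by the top form. It is linear on the whole ring
  because the right factors of \<open>coact W x\<close> range over all of it.\<close>

definition top_coeff :: "'w \<Rightarrow> 'w" where
  "top_coeff = (SOME g. Vector_Spaces.linear (smult W) (smult W) g \<and>
     (\<forall>x\<in>qsl2 W. g (x * (ep * em * e0)) = x))"

lemma top_coeff: "Vector_Spaces.linear (smult W) (smult W) top_coeff"
    "x \<in> qsl2 W \<Longrightarrow> top_coeff (x * (ep * em * e0)) = x"
proof -
  interpret vp: vector_space_pair "smult W" "smult W" ..
  have "Vector_Spaces.linear (smult W) (smult W) (\<lambda>x. x * (ep * em * e0))"
    by unfold_locales (simp_all add: distrib_right smult_mult_left)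
  \<comment> \<open>Freeness makes multiplication by the top form injective on the subspace
    \<open>qsl2 W\<close>, so a linear left inverse exists.\<close>
  moreover have "inj_on (\<lambda>x. x * (ep * em * e0)) (qsl2 W)"
  proof (rule inj_onI)
    fix x y assume "x \<in> qsl2 W" "y \<in> qsl2 W" "x * (ep * em * e0) = y * (ep * em * e0)"
    then show "x = y"
      using ext_unique[of 0 0 0 0 0 x 0 0 0 0 0 y] vs.subspace_0[OF qsl2_subspace] by simp
  qed
  ultimately have "\<exists>g. Vector_Spaces.linear (smult W) (smult W) g \<and>
     (\<forall>x\<in>qsl2 W. g (x * (ep * em * e0)) = x)"
    using vp.linear_exists_left_inverse_on[OF _ qsl2_subspace] by blast
  from someI_ex[OF this] show "Vector_Spaces.linear (smult W) (smult W) top_coeff"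
    "x \<in> qsl2 W \<Longrightarrow> top_coeff (x * (ep * em * e0)) = x"
    unfolding top_coeff_def by blast+
qed

text \<open>The operators \<open>\<partial>\<^sub>+\<close> and \<open>\<partial>\<^sub>-\<close>; the scalar in the second undoes \<open>e\<^sup>- e\<^sup>+ = - q\<^sup>2 e\<^sup>+ e\<^sup>-\<close>.\<close>

definition dp :: "'w \<Rightarrow> 'w" where
  "dp x = top_coeff (dif W x * (em * e0))"

definition dm :: "'w \<Rightarrow> 'w" where
  "dm x = - inverse (q\<^sup>2) \<cdot> top_coeff (dif W x * (ep * e0))"

lemma dpm_linear:
  "dp (x + y) = dp x + dp y" "dm (x + y) = dm x + dm y"
  "dp (z \<cdot> x) = z \<cdot> dp x" "dm (z \<cdot> x) = z \<cdot> dm x"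
proof -
  interpret l: Vector_Spaces.linear "smult W" "smult W" top_coeff by (rule top_coeff)
  show "dp (x + y) = dp x + dp y" "dm (x + y) = dm x + dm y"
    "dp (z \<cdot> x) = z \<cdot> dp x" "dm (z \<cdot> x) = z \<cdot> dm x"
    by (simp_all add: dp_def dm_def dif_add dif_smult distrib_right l.add l.scale smult_mult_left
        vs.scale_right_distrib vs.scale_left_commute)
qed

text \<open>Invariant forms square to zero and anticommute up to scalars, so multiplying by
  \<open>em * e0\<close> leaves only the \<open>ep\<close> term and multiplying by
  \<open>ep * e0\<close> only the \<open>em\<close> term.\<close>

lemma dpm_eqI:
  assumes "dif W x = y * ep + z * em + w * e0" "y \<in> qsl2 W" "z \<in> qsl2 W"
  shows "dp x = y" "dm x = z"
proof -
  interpret l: Vector_Spaces.linear "smult W" "smult W" top_coeff by (rule top_coeff)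
  have "dif W x * (em * e0) = y * (ep * em * e0)"
    by (simp add: assms(1) distrib_right mult.assoc wedge_rules scale_simps)
  then show "dp x = y" by (simp add: dp_def top_coeff assms)
  have "dif W x * (ep * e0) = - (q\<^sup>2 \<cdot> (z * (ep * em * e0)))"
    by (simp add: assms(1) distrib_right mult.assoc wedge_rules scale_simps)
  then show "dm x = z" using q_nonzero by (simp add: dm_def l.neg l.scale top_coeff assms)
qed

section \<open>The differential on homogeneous elements\<close>

lemma dif_one [simp]: "dif W 1 = 0"
  using dif_leibniz[of 1 0 1] homog_one homog_subset_qsl2 by auto

lemma dif_mult: "x \<in> homog W n \<Longrightarrow> dif W (x * y) = dif W x * y + x * dif W y"
  using dif_leibniz[of x 0 y] homog_subset_qsl2 by auto

lemma dif_zero [simp]: "dif W 0 = 0"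
  using dif_add[of 0 0] by simp

text \<open>The twist in the Leibniz rule is the cost of moving the forms in \<open>dif W x\<close>
  to the right of \<open>y\<close>: \<open>q powi n\<close> for \<open>ep\<close> and
  \<open>em\<close>, its square for \<open>e0\<close>.\<close>

lemma dif_mult_form:
  assumes x: "x \<in> homog W m" and y: "y \<in> homog W n"
    and dx: "dif W x = x1 * ep + x2 * em + z \<cdot> (x * e0)"
    and dy: "dif W y = y1 * ep + y2 * em + z' \<cdot> (y * e0)"
  shows "dif W (x * y) = (q powi n \<cdot> (x1 * y) + x * y1) * ep + (q powi n \<cdot> (x2 * y) + x * y2) * em
    + (q powi (2 * n) * z + z') \<cdot> (x * y * e0)"
  by (simp add: dif_mult[OF x] dx dy distrib_left distrib_right scale_simps mult.assoc
      frm_commute[OF y] vs.scale_left_distrib mult.commute add_ac)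

text \<open>Existence of the decomposition of the differential, in a form that can be proved by
  induction over words; \<open>dpm_eqI\<close> then identifies the coefficients with
  \<open>dp x\<close> and \<open>dm x\<close>.\<close>

definition derivable :: "int \<Rightarrow> 'w \<Rightarrow> bool" where
  "derivable n x \<longleftrightarrow> x \<in> homog W n \<and> (\<exists>y\<in>homog W (n - 2). \<exists>z\<in>homog W (n + 2).
     dif W x = y * ep + z * em + q_int (q\<^sup>2) n \<cdot> (x * e0))"

lemma derivable_mult:
  assumes "derivable m x" "derivable n y"
  shows "derivable (m + n) (x * y)"
proof -
  obtain x1 x2 where x: "x1 \<in> homog W (m - 2)" "x2 \<in> homog W (m + 2)" "x \<in> homog W m"
    and dx: "dif W x = x1 * ep + x2 * em + q_int (q\<^sup>2) m \<cdot> (x * e0)"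
    using assms(1) by (auto simp: derivable_def)
  obtain y1 y2 where y: "y1 \<in> homog W (n - 2)" "y2 \<in> homog W (n + 2)" "y \<in> homog W n"
    and dy: "dif W y = y1 * ep + y2 * em + q_int (q\<^sup>2) n \<cdot> (y * e0)"
    using assms(2) by (auto simp: derivable_def)
  have "q powi (2 * n) * q_int (q\<^sup>2) m + q_int (q\<^sup>2) n = q_int (q\<^sup>2) (m + n)"
    using q_nonzero by (simp add: q_int_add power_int_mult)
  note d = dif_mult_form[OF x(3) y(3) dx dy, unfolded this]
  moreover have "x1 * y \<in> homog W (m + n - 2)" "x * y1 \<in> homog W (m + n - 2)"
    "x2 * y \<in> homog W (m + n + 2)" "x * y2 \<in> homog W (m + n + 2)"
    by (rule homog_mult'[OF x(1) y(3)] homog_mult'[OF x(3) y(1)] homog_mult'[OF x(2) y(3)]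
          homog_mult'[OF x(3) y(2)]; simp)+
  ultimately show ?thesis
    unfolding derivable_def
    using homog_mult[OF x(3) y(3)] by (blast intro: homog_add homog_smult)
qed

lemma derivable_gen: "derivable (gen_deg g) (gen W g)"
proof -
  \<comment> \<open>This is the coefficient of \<open>e0\<close> in the differentials of
    \<open>gb\<close> and \<open>gd\<close>.\<close>
  have "q_int (q\<^sup>2) (- 1) = - (q powi (- 2))"
    using q_nonzero by (simp add: q_int_minus_one power_int_minus)
  moreover have "0 \<in> homog W n" "q \<cdot> gb \<in> homog W (- 1)" "q \<cdot> gd \<in> homog W (- 1)" for n
    using homog_gens by (auto intro: homog_smult)
  moreover note homog_gens
  ultimately show ?thesis
    by (cases g; simp add: derivable_def dif_a dif_b dif_c dif_d)
      (rule bexI[of _ "q \<cdot> gb"] bexI[of _ "0"] bexI[of _ ga] bexI[of _ gc] bexI[of _ "q \<cdot> gd"]; 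
       (rule bexI[of _ 0] bexI[of _ ga] bexI[of _ gc])?; simp add: scale_simps)+
qed

lemma derivable_word: "derivable (word_deg w) (word_val W w)"
proof (cases w)
  case (QWord gs)
  have "derivable (word_deg (QWord gs)) (word_val W (QWord gs))"
  proof (induction gs)
    case Nil
    show ?case using homog_one by (auto simp: derivable_def word_deg_def word_val_def intro!: bexI[of _ 0])
  next
    case (Cons g gs)
    then show ?case
      using derivable_mult[OF derivable_gen Cons] by (simp add: word_val_def word_deg_def)
  qed
  with QWord show ?thesis by simp
qed

lemma derivable: "x \<in> homog W n \<Longrightarrow> derivable n x"
proof (induction rule: homog_induct)
  case zero
  show ?case by (auto simp: derivable_def intro!: bexI[of _ 0])
next
  case (add z w x)
  obtain x1 x2 where x: "x1 \<in> homog W (n - 2)" "x2 \<in> homog W (n + 2)" "x \<in> homog W n"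
    and dx: "dif W x = x1 * ep + x2 * em + q_int (q\<^sup>2) n \<cdot> (x * e0)"
    using add by (auto simp: derivable_def)
  obtain y1 y2 where y: "y1 \<in> homog W (n - 2)" "y2 \<in> homog W (n + 2)" "word_val W w \<in> homog W n"
    and dy: "dif W (word_val W w) = y1 * ep + y2 * em + q_int (q\<^sup>2) n \<cdot> (word_val W w * e0)"
    using derivable_word[of w] \<open>word_deg w = n\<close> by (auto simp: derivable_def)
  show ?case
    unfolding derivable_def
    by (intro conjI bexI[of _ "z \<cdot> y1 + x1"] bexI[of _ "z \<cdot> y2 + x2"] homog_add homog_smult x y)
      (simp add: dif_add dif_smult dx dy scale_simps distrib_right mult.commute add_ac)
qed

lemma
  assumes x: "x \<in> homog W n"
  shows dif_homog: "dif W x = dp x * ep + dm x * em + q_int (q\<^sup>2) n \<cdot> (x * e0)"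
    and dp_homog: "dp x \<in> homog W (n - 2)"
    and dm_homog: "dm x \<in> homog W (n + 2)"
proof -
  obtain y z where yz: "y \<in> homog W (n - 2)" "z \<in> homog W (n + 2)"
    and d: "dif W x = y * ep + z * em + q_int (q\<^sup>2) n \<cdot> (x * e0)"
    using derivable[OF x] by (auto simp: derivable_def)
  have "dp x = y" "dm x = z"
    using dpm_eqI[of x y z "q_int (q\<^sup>2) n \<cdot> x"] d yz homog_subset_qsl2 by (auto simp: smult_mult_left)
  with yz d show "dif W x = dp x * ep + dm x * em + q_int (q\<^sup>2) n \<cdot> (x * e0)"
    "dp x \<in> homog W (n - 2)" "dm x \<in> homog W (n + 2)" by simp_all
qed

lemma
  assumes x: "x \<in> homog W m" and y: "y \<in> homog W n"
  shows dp_mult: "dp (x * y) = q powi n \<cdot> (dp x * y) + x * dp y"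
    and dm_mult: "dm (x * y) = q powi n \<cdot> (dm x * y) + x * dm y"
proof -
  have "dp x * y \<in> homog W (m + n - 2)" "x * dp y \<in> homog W (m + n - 2)"
    "dm x * y \<in> homog W (m + n + 2)" "x * dm y \<in> homog W (m + n + 2)"
    by (rule homog_mult'[OF dp_homog[OF x] y] homog_mult'[OF x dp_homog[OF y]]
      homog_mult'[OF dm_homog[OF x] y] homog_mult'[OF x dm_homog[OF y]]; simp)+
  then have "q powi n \<cdot> (dp x * y) + x * dp y \<in> qsl2 W" "q powi n \<cdot> (dm x * y) + x * dm y \<in> qsl2 W"
    using homog_subset_qsl2 homog_add homog_smult by blast+
  with dif_mult_form[OF x y dif_homog[OF x] dif_homog[OF y]]
  show "dp (x * y) = q powi n \<cdot> (dp x * y) + x * dp y" "dm (x * y) = q powi n \<cdot> (dm x * y) + x * dm y"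
    using dpm_eqI[of "x * y"] by (auto simp flip: smult_mult_left)
qed

lemma dpm_gens:
  "dp ga = q \<cdot> gb" "dm ga = 0" "dp gb = 0" "dm gb = ga"
  "dp gc = q \<cdot> gd" "dm gc = 0" "dp gd = 0" "dm gd = gc"
proof -
  have "0 \<in> qsl2 W" "q \<cdot> gb \<in> qsl2 W" "q \<cdot> gd \<in> qsl2 W" "ga \<in> qsl2 W" "gc \<in> qsl2 W"
    using homog_gens homog_zero homog_smult homog_subset_qsl2 by blast+
  then show "dp ga = q \<cdot> gb" "dm ga = 0" "dp gb = 0" "dm gb = ga"
  "dp gc = q \<cdot> gd" "dm gc = 0" "dp gd = 0" "dm gd = gc"
    using dpm_eqI[of ga "q \<cdot> gb" 0 ga] dpm_eqI[of gc "q \<cdot> gd" 0 gc]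
      dpm_eqI[of gb 0 ga "- (q powi (- 2) \<cdot> gb)"] dpm_eqI[of gd 0 gc "- (q powi (- 2) \<cdot> gd)"]
    by (simp_all add: dif_a dif_b dif_c dif_d smult_mult_left)
qed

section \<open>The sphere and its spinors\<close>


text \<open>Keeps the exponent visible, so that scalars in long products combine by adding
  integers.\<close>

definition qs :: "int \<Rightarrow> 'w \<Rightarrow> 'w" where
  "qs n x = q powi n \<cdot> x"

lemma qs_simps:
  "x * qs n y = qs n (x * y)" "qs n x * y = qs n (x * y)" "qs m (qs n x) = qs (m + n) x"
  "qs n (x + y) = qs n x + qs n y" "qs n (x - y) = qs n x - qs n y" "qs n (- x) = - qs n x"
  "qs 0 x = x" "qs n 0 = 0"
  using q_nonzero by (simp_all add: qs_def scale_simps power_int_add)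

lemma scale_qs:
  "q \<cdot> x = qs 1 x" "inverse q \<cdot> x = qs (- 1) x" "q powi n \<cdot> x = qs n x"
  "q ^ k \<cdot> x = qs (int k) x" "(z + w) \<cdot> x = z \<cdot> x + w \<cdot> x" "(1::complex) \<cdot> x = x"
  "(q * z) \<cdot> x = qs 1 (z \<cdot> x)" "(inverse q * z) \<cdot> x = qs (- 1) (z \<cdot> x)"
  by (simp_all add: qs_def vs.scale_left_distrib)

text \<open>Rewriting to the basis of monomials with the powers of \<open>b\<close> and \<open>c\<close> in front, where
  every product of \<open>a\<close> and \<open>d\<close> can be eliminated.\<close>

lemma normal_rels:
  "ga * gb = qs (- 1) (gb * ga)" "ga * gc = qs (- 1) (gc * ga)"
  "gd * gb = qs 1 (gb * gd)" "gd * gc = qs 1 (gc * gd)" "gc * gb = gb * gc"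
  "ga * gd = 1 + qs (- 1) (gb * gc)" "gd * ga = 1 + qs 1 (gb * gc)"
  using gen_relations q_nonzero by (simp_all add: scale_simps scale_qs qs_simps)

lemmas normal_simps = normal_rels normal_rels[THEN mult_left_assoc_eq] qs_simps scale_qs
  distrib_left distrib_right left_diff_distrib right_diff_distrib mult.assoc

section \<open>Forms on the quantum sphere\<close>

lemma homog_qs: "x \<in> homog W n \<Longrightarrow> qs m x \<in> homog W n"
  by (simp add: qs_def homog_smult)

lemma gens_homog2:
  "x \<in> homog W 1 \<Longrightarrow> y \<in> homog W 1 \<Longrightarrow> x * y \<in> homog W 2"
  "x \<in> homog W 1 \<Longrightarrow> y \<in> homog W (- 1) \<Longrightarrow> x * y \<in> homog W 0"
  "x \<in> homog W (- 1) \<Longrightarrow> y \<in> homog W 1 \<Longrightarrow> x * y \<in> homog W 0"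
  "x \<in> homog W (- 1) \<Longrightarrow> y \<in> homog W (- 1) \<Longrightarrow> x * y \<in> homog W (- 2)"
  using homog_mult'[of x _ y] by auto

lemma dif_sphere: "f \<in> homog W 0 \<Longrightarrow> dif W f = dp f * ep + dm f * em"
  using dif_homog[of f 0] by simp

lemma dpm_sphere_gens:
  "dp (ga * gb) = gb * gb" "dm (ga * gb) = ga * ga"
  "dp (gb * gc) = qs 1 (gb * gd)" "dm (gb * gc) = qs 1 (ga * gc)"
  "dp (gc * gd) = gd * gd" "dm (gc * gd) = gc * gc"
  by (simp_all add: dp_mult[OF homog_gens(1,2)] dm_mult[OF homog_gens(1,2)]
      dp_mult[OF homog_gens(2,3)] dm_mult[OF homog_gens(2,3)]
      dp_mult[OF homog_gens(3,4)] dm_mult[OF homog_gens(3,4)] dpm_gens scale_qs qs_simps)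

text \<open>The differentials of the three coordinates are solved for \<open>ep\<close> and
  \<open>em\<close>. At \<open>q = 1\<close> the coefficient of the wanted form on the right is the
  square of the determinant \<open>ad - bc = 1\<close>, and the other coefficient cancels.\<close>

lemma frm_expand:
  "ep = ga * ga * dif W (gc * gd) - (ga * gc + qs (- 2) (ga * gc)) * dif W (gb * gc)
     + qs (- 2) (gc * gc) * dif W (ga * gb)"
  "em = gd * gd * dif W (ga * gb) - (qs 1 (gd * gb) + qs (- 1) (gd * gb)) * dif W (gb * gc)
     + qs 2 (gb * gb) * dif W (gc * gd)"
proof -
  have d: "dif W (ga * gb) = gb * gb * ep + ga * ga * em"
    "dif W (gb * gc) = qs 1 (gb * gd) * ep + qs 1 (ga * gc) * em"
    "dif W (gc * gd) = gd * gd * ep + gc * gc * em"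
    by (simp_all add: dif_sphere gens_homog2 homog_gens dpm_sphere_gens)
  show "ep = ga * ga * dif W (gc * gd) - (ga * gc + qs (- 2) (ga * gc)) * dif W (gb * gc)
     + qs (- 2) (gc * gc) * dif W (ga * gb)"
    "em = gd * gd * dif W (ga * gb) - (qs 1 (gd * gb) + qs (- 1) (gd * gb)) * dif W (gb * gc)
     + qs 2 (gb * gb) * dif W (gc * gd)"
    unfolding d by (simp_all add: normal_simps)
qed

lemma sphere_forms_mult_dif:
  "g \<in> homog W 0 \<Longrightarrow> f \<in> homog W 0 \<Longrightarrow> g * dif W f \<in> sphere_forms W"
  by (intro sphere_forms.intros)

text \<open>Multiplied by \<open>h\<close>, the coefficients in \<open>frm_expand\<close> acquire
  degree zero and are functions on the sphere.\<close>

lemma sphere_forms_frm: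
  "h \<in> homog W (- 2) \<Longrightarrow> h * ep \<in> sphere_forms W"
  "h \<in> homog W 2 \<Longrightarrow> h * em \<in> sphere_forms W"
proof -
  assume h: "h \<in> homog W (- 2)"
  have H: "h * y \<in> homog W 0" if "y \<in> homog W 2" for y
    using homog_mult'[OF h that] by simp
  have eq: "h * ep = (h * (ga * ga)) * dif W (gc * gd)
      + (h * - (ga * gc + qs (- 2) (ga * gc))) * dif W (gb * gc)
      + (h * qs (- 2) (gc * gc)) * dif W (ga * gb)"
    by (subst frm_expand(1)) (simp add: algebra_simps)
  show "h * ep \<in> sphere_forms W"
    unfolding eq
    by (intro sphere_forms.add sphere_forms_mult_dif H homog_uminus homog_add homog_qs gens_homog2 homog_gens)
next
  assume h: "h \<in> homog W 2"
  have H: "h * y \<in> homog W 0" if "y \<in> homog W (- 2)" for y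
    using homog_mult'[OF h that] by simp
  have eq: "h * em = (h * (gd * gd)) * dif W (ga * gb)
      + (h * - (qs 1 (gd * gb) + qs (- 1) (gd * gb))) * dif W (gb * gc)
      + (h * qs 2 (gb * gb)) * dif W (gc * gd)"
    by (subst frm_expand(2)) (simp add: algebra_simps)
  show "h * em \<in> sphere_forms W"
    unfolding eq
    by (intro sphere_forms.add sphere_forms_mult_dif H homog_uminus homog_add homog_qs gens_homog2 homog_gens)
qed

text \<open>A normal form without \<open>e0\<close> that will be shown to contain every element of
  \<open>sphere_forms W\<close>.\<close>

definition sphere_form :: "'w \<Rightarrow> bool" where
  "sphere_form \<omega> \<longleftrightarrow> (\<exists>f\<in>homog W 0. \<exists>g\<in>homog W (- 2). \<exists>h\<in>homog W 2. \<exists>k\<in>homog W 0.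
     \<omega> = f + g * ep + h * em + k * (ep * em))"

lemma sphere_formI:
  "f \<in> homog W 0 \<Longrightarrow> g \<in> homog W (- 2) \<Longrightarrow> h \<in> homog W 2 \<Longrightarrow> k \<in> homog W 0 \<Longrightarrow>
    \<omega> = f + g * ep + h * em + k * (ep * em) \<Longrightarrow> sphere_form \<omega>"
  by (auto simp: sphere_form_def)

lemma sphere_form_mult:
  assumes "sphere_form \<omega>" "sphere_form \<eta>"
  shows "sphere_form (\<omega> * \<eta>)"
proof -
  obtain f g h k where \<omega>: "f \<in> homog W 0" "g \<in> homog W (- 2)" "h \<in> homog W 2" "k \<in> homog W 0"
    "\<omega> = f + g * ep + h * em + k * (ep * em)" using assms(1) by (auto simp: sphere_form_def)
  obtain f' g' h' k' where \<eta>: "f' \<in> homog W 0" "g' \<in> homog W (- 2)" "h' \<in> homog W 2" "k' \<in> homog W 0"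
    "\<eta> = f' + g' * ep + h' * em + k' * (ep * em)" using assms(2) by (auto simp: sphere_form_def)
  note c = frm_commute[OF \<eta>(1)] frm_commute[OF \<eta>(2)] frm_commute[OF \<eta>(3)] frm_commute[OF \<eta>(4)]
  show ?thesis
  proof (rule sphere_formI)
    \<comment> \<open>Moving \<open>ep\<close> past \<open>h'\<close> gives \<open>q^2\<close>.
      Moving \<open>em\<close> past \<open>g'\<close> gives \<open>q^-2\<close>, which the factor
      \<open>-q^2\<close> from reordering \<open>em * ep\<close> turns into a bare sign.\<close>
    show "\<omega> * \<eta> = f * f' + (f * g' + g * f') * ep + (f * h' + h * f') * em
      + (f * k' + k * f' + qs 2 (g * h') - h * g') * (ep * em)"
      using q_nonzero
      by (simp add: \<omega>(5) \<eta>(5) distrib_left distrib_right left_diff_distrib mult.assoc c c[THEN mult_left_assoc_eq]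
          scale_simps wedge_rules scale_qs qs_simps)
  qed (use homog_mult'[OF \<omega>(1) \<eta>(1)] homog_mult'[OF \<omega>(1) \<eta>(2)] homog_mult'[OF \<omega>(2) \<eta>(1)]
       homog_mult'[OF \<omega>(1) \<eta>(3)] homog_mult'[OF \<omega>(3) \<eta>(1)] homog_mult'[OF \<omega>(1) \<eta>(4)]
       homog_mult'[OF \<omega>(4) \<eta>(1)] homog_mult'[OF \<omega>(2) \<eta>(3)] homog_mult'[OF \<omega>(3) \<eta>(2)]
       in \<open>auto intro!: homog_add homog_diff homog_qs\<close>)
qed

lemma sphere_forms_sphere_form: "\<omega> \<in> sphere_forms W \<Longrightarrow> sphere_form \<omega>"
proof (induction rule: sphere_forms.induct)
  case (base f)
  then show ?case by (intro sphere_formI[of f 0 0 0]) auto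
next
  case (dif f)
  then show ?case
    using dp_homog[OF dif] dm_homog[OF dif]
    by (intro sphere_formI[of 0 "dp f" "dm f" 0]) (auto simp: dif_sphere)
next
  case (add \<omega> \<eta>)
  obtain f g h k where \<omega>: "f \<in> homog W 0" "g \<in> homog W (- 2)" "h \<in> homog W 2" "k \<in> homog W 0"
    "\<omega> = f + g * ep + h * em + k * (ep * em)" using add by (auto simp: sphere_form_def)
  obtain f' g' h' k' where \<eta>: "f' \<in> homog W 0" "g' \<in> homog W (- 2)" "h' \<in> homog W 2" "k' \<in> homog W 0"
    "\<eta> = f' + g' * ep + h' * em + k' * (ep * em)" using add by (auto simp: sphere_form_def)
  show ?case
    by (rule sphere_formI[of "f + f'" "g + g'" "h + h'" "k + k'"])
      (use \<omega> \<eta> in \<open>auto simp: distrib_right intro: homog_add\<close>)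
next
  case (mult \<omega> \<eta>)
  then show ?case by (simp add: sphere_form_mult)
qed

lemma forms1_expand:
  "\<omega> \<in> forms W 1 \<Longrightarrow> \<exists>x\<in>qsl2 W. \<exists>y\<in>qsl2 W. \<exists>z\<in>qsl2 W. \<omega> = x * ep + y * em + z * e0"
  unfolding One_nat_def forms.simps
proof (induction rule: vs.span_induct_alt)
  case base
  show ?case using vs.subspace_0[OF qsl2_subspace] by (intro bexI[of _ 0]) auto
next
  case (step z \<eta> \<omega>)
  then obtain x s where \<eta>: "\<eta> = x * frm W s" "x \<in> qsl2 W" by auto
  obtain x1 x2 x3 where \<omega>: "x1 \<in> qsl2 W" "x2 \<in> qsl2 W" "x3 \<in> qsl2 W"
    "\<omega> = x1 * ep + x2 * em + x3 * e0" using step by auto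
  note mem = vs.subspace_add[OF qsl2_subspace] vs.subspace_scale[OF qsl2_subspace]
  show ?case
  proof (cases s)
    case EP
    show ?thesis
      by (intro bexI[of _ "z \<cdot> x + x1"] bexI[of _ x2] bexI[of _ x3])
        (use EP \<eta> \<omega> mem in \<open>auto simp: distrib_right smult_mult_left add_ac\<close>)
  next
    case EM
    show ?thesis
      by (intro bexI[of _ x1] bexI[of _ "z \<cdot> x + x2"] bexI[of _ x3])
        (use EM \<eta> \<omega> mem in \<open>auto simp: distrib_right smult_mult_left add_ac\<close>)
  next
    case E0
    show ?thesis
      by (intro bexI[of _ x1] bexI[of _ x2] bexI[of _ "z \<cdot> x + x3"])
        (use E0 \<eta> \<omega> mem in \<open>auto simp: distrib_right smult_mult_left add_ac\<close>)
  qed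
qed

lemma sphere1_eq: "sphere1 W = {f * ep + g * em |f g. f \<in> homog W (- 2) \<and> g \<in> homog W 2}"
proof (intro equalityI subsetI)
  fix \<omega> assume "\<omega> \<in> sphere1 W"
  then have 1: "\<omega> \<in> forms W 1" and "sphere_form \<omega>"
    by (auto simp: sphere1_def intro: sphere_forms_sphere_form)
  then obtain f g h k where fghk: "f \<in> homog W 0" "g \<in> homog W (- 2)" "h \<in> homog W 2" "k \<in> homog W 0"
    "\<omega> = f + g * ep + h * em + k * (ep * em)" by (auto simp: sphere_form_def)
  obtain x y z where xyz: "x \<in> qsl2 W" "y \<in> qsl2 W" "z \<in> qsl2 W" "\<omega> = x * ep + y * em + z * e0"
    using forms1_expand[OF 1] by auto
  \<comment> \<open>The parts of form degree 0 and 2 are removed by comparison with the expansion of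
    a one-form.\<close>
  have "f = 0 \<and> g = x \<and> h = y \<and> k = 0 \<and> 0 = z \<and> (0::'w) = 0"
    by (rule ext_unique) (use fghk xyz homog_subset_qsl2 vs.subspace_0[OF qsl2_subspace] in auto)
  with fghk show "\<omega> \<in> {f * ep + g * em |f g. f \<in> homog W (- 2) \<and> g \<in> homog W 2}" by auto
next
  fix \<omega> assume "\<omega> \<in> {f * ep + g * em |f g. f \<in> homog W (- 2) \<and> g \<in> homog W 2}"
  then obtain f g where \<omega>: "\<omega> = f * ep + g * em" "f \<in> homog W (- 2)" "g \<in> homog W 2" by auto
  have "x * frm W s \<in> forms W 1" if "x \<in> homog W n" for x n s
    using that homog_subset_qsl2 by (auto intro!: vs.span_base)
  moreover have "x + y \<in> forms W 1" if "x \<in> forms W 1" "y \<in> forms W 1" for x y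
    using that by (auto intro: vs.span_add)
  ultimately show "\<omega> \<in> sphere1 W"
    using \<omega> sphere_forms_frm by (auto simp: sphere1_def intro: sphere_forms.add)
qed

lemma sphere1I: "f \<in> homog W (- 2) \<Longrightarrow> g \<in> homog W 2 \<Longrightarrow> f * ep + g * em \<in> sphere1 W"
  by (auto simp: sphere1_eq)

lemma sphere1E:
  assumes "\<omega> \<in> sphere1 W"
  obtains f g where "\<omega> = f * ep + g * em" "f \<in> homog W (- 2)" "g \<in> homog W 2"
  using assms by (auto simp: sphere1_eq)

lemma form1_unique:
  assumes "f \<in> homog W m" "g \<in> homog W n" "f' \<in> homog W m'" "g' \<in> homog W n'"
    and "f * ep + g * em = f' * ep + g' * em"
  shows "f = f' \<and> g = g'"
  using ext_unique[of 0 f g 0 0 0 0 f' g' 0 0 0] assms homog_subset_qsl2 vs.subspace_0[OF qsl2_subspace]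
  by auto

lemma form1_mult_right:
  assumes "r \<in> homog W n"
  shows "(f * ep + g * em) * r = qs n (f * r) * ep + qs n (g * r) * em"
  by (simp add: distrib_right mult.assoc frm_commute[OF assms] scale_simps scale_qs qs_simps)

lemma sphere1_diff: "\<omega> \<in> sphere1 W \<Longrightarrow> \<eta> \<in> sphere1 W \<Longrightarrow> \<omega> - \<eta> \<in> sphere1 W"
proof (elim sphere1E)
  fix f g f' g'
  assume *: "f \<in> homog W (- 2)" "g \<in> homog W 2" "f' \<in> homog W (- 2)" "g' \<in> homog W 2"
    "\<omega> = f * ep + g * em" "\<eta> = f' * ep + g' * em"
  then have "\<omega> - \<eta> = (f - f') * ep + (g - g') * em" by (simp add: left_diff_distrib)
  with * show ?thesis by (metis sphere1I homog_diff)
qed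

lemma sphere1_zero: "0 \<in> sphere1 W"
  using sphere1I[of 0 0] by simp

text \<open>Places the left factors of the later \<open>tensor_rep\<close> in
  \<open>sphere1 W\<close>: an element of degree \<open>- n\<close> balances a one-form of total
  degree \<open>n\<close>.\<close>

lemma form1_mult_sphere1:
  assumes "x \<in> homog W (n - 2)" "y \<in> homog W (n + 2)" "r \<in> homog W (- n)"
  shows "(x * ep + y * em) * r \<in> sphere1 W"
  unfolding form1_mult_right[OF assms(3)]
  by (intro sphere1I homog_qs homog_mult'[OF assms(1,3)] homog_mult'[OF assms(2,3)]) simp_all

lemma sphere1_mult: "\<omega> \<in> sphere1 W \<Longrightarrow> r \<in> homog W 0 \<Longrightarrow> \<omega> * r \<in> sphere1 W"
  using form1_mult_sphere1[where n = 0] by (auto elim!: sphere1E)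

section \<open>Projections and Clifford action\<close>

lemma proj_eq:
  assumes "f \<in> homog W (- 2)" "g \<in> homog W 2"
  shows "proj10 W (f * ep + g * em) = f * ep" "proj01 W (f * ep + g * em) = g * em"
  unfolding proj10_def proj01_def forms10_def forms01_def
  by (rule the_equality; use assms form1_unique[OF assms, of _ "- 2" _ 2] in blast)+

text \<open>The difference of the first components equals a difference of second ones, hence has
  degree 1 and -1 at once and vanishes.\<close>

lemma spinor_unique:
  assumes "\<sigma> \<in> homog W 1" "\<tau> \<in> homog W (- 1)" "\<sigma>' \<in> homog W 1" "\<tau>' \<in> homog W (- 1)"
    and "\<sigma> + \<tau> = \<sigma>' + \<tau>'"
  shows "\<sigma> = \<sigma>' \<and> \<tau> = \<tau>'"
proof -
  have "\<sigma> - \<sigma>' = \<tau>' - \<tau>" using assms(5) by (simp add: algebra_simps)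
  moreover have "\<sigma> - \<sigma>' \<in> homog W 1" "\<tau>' - \<tau> \<in> homog W (- 1)"
    using assms by (simp_all add: homog_diff)
  moreover have "(1::int) \<noteq> - 1" by simp
  ultimately have "\<sigma> - \<sigma>' = 0"
    using homog_disjoint[of "\<sigma> - \<sigma>'" 1 "- 1"] by metis
  with assms(5) show ?thesis by simp
qed

lemma clifford_pure_eq:
  assumes "f \<in> homog W (- 2)" "g \<in> homog W 2" "\<sigma> \<in> homog W 1" "\<tau> \<in> homog W (- 1)"
  shows "clifford_pure W (f * ep + g * em) (\<sigma> + \<tau>) = f * \<sigma> + g * \<tau>"
  unfolding clifford_pure_def spinor_minus_def spinor_plus_def
proof (rule the_equality)
  fix y assume "\<exists>f'\<in>homog W (- 2). \<exists>g'\<in>homog W 2. \<exists>\<sigma>'\<in>homog W 1. \<exists>\<tau>'\<in>homog W (- 1).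
    f * ep + g * em = f' * ep + g' * em \<and> \<sigma> + \<tau> = \<sigma>' + \<tau>' \<and> y = f' * \<sigma>' + g' * \<tau>'"
  then show "y = f * \<sigma> + g * \<tau>"
    using form1_unique[OF assms(1,2)] spinor_unique[OF assms(3,4)] by blast
qed (use assms in blast)

lemma clifford_pure_minus:
  "f \<in> homog W (- 2) \<Longrightarrow> g \<in> homog W 2 \<Longrightarrow> \<sigma> \<in> homog W 1 \<Longrightarrow>
    clifford_pure W (f * ep + g * em) \<sigma> = f * \<sigma>"
  using clifford_pure_eq[of f g \<sigma> 0] by simp

lemma clifford_pure_plus:
  "f \<in> homog W (- 2) \<Longrightarrow> g \<in> homog W 2 \<Longrightarrow> \<tau> \<in> homog W (- 1) \<Longrightarrow>
    clifford_pure W (f * ep + g * em) \<tau> = g * \<tau>"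
  using clifford_pure_eq[of f g 0 \<tau>] by simp

lemma clifford_tclass:
  assumes n: "n = 1 \<or> n = - 1"
    and u: "Poly_Mapping.keys u \<subseteq> sphere1 W \<times> homog W n"
  shows "clifford W (tclass (sphere1 W) (homog W 0) (homog W n) u) = feval (clifford_pure W) u"
  unfolding clifford_def
proof (rule tlift_tclass[OF _ _ _ u])
  fix m m' \<sigma> assume \<sigma>: "\<sigma> \<in> homog W n" and "m \<in> sphere1 W" "m' \<in> sphere1 W"
  then obtain f g f' g' where m: "m = f * ep + g * em" "f \<in> homog W (- 2)" "g \<in> homog W 2"
    and m': "m' = f' * ep + g' * em" "f' \<in> homog W (- 2)" "g' \<in> homog W 2"
    by (elim sphere1E)
  have eq: "m + m' = (f + f') * ep + (g + g') * em" by (simp add: m m' distrib_right)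
  show "clifford_pure W (m + m') \<sigma> = clifford_pure W m \<sigma> + clifford_pure W m' \<sigma>"
    unfolding eq unfolding m(1) m'(1) using n m(2,3) m'(2,3) \<sigma>
    by (elim disjE; simp add: clifford_pure_minus clifford_pure_plus homog_add)
      (simp_all add: distrib_right)
next
  fix m \<sigma> \<sigma>' assume "m \<in> sphere1 W" and \<sigma>: "\<sigma> \<in> homog W n" "\<sigma>' \<in> homog W n"
  then obtain f g where m: "m = f * ep + g * em" "f \<in> homog W (- 2)" "g \<in> homog W 2"
    by (elim sphere1E)
  show "clifford_pure W m (\<sigma> + \<sigma>') = clifford_pure W m \<sigma> + clifford_pure W m \<sigma>'"
    using n m \<sigma> by (auto simp: clifford_pure_minus clifford_pure_plus homog_add distrib_left)
next
  fix m r \<sigma> assume "m \<in> sphere1 W" and r: "r \<in> homog W 0" and \<sigma>: "\<sigma> \<in> homog W n"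
  then obtain f g where m: "m = f * ep + g * em" "f \<in> homog W (- 2)" "g \<in> homog W 2"
    by (elim sphere1E)
  \<comment> \<open>An element of degree zero passes \<open>ep\<close> and \<open>em\<close> without
    a scalar, which gives balancedness.\<close>
  have eq: "m * r = (f * r) * ep + (g * r) * em"
    unfolding m(1) form1_mult_right[OF r] by (simp add: qs_simps)
  have "f * r \<in> homog W (- 2)" "g * r \<in> homog W 2" "r * \<sigma> \<in> homog W n"
    using homog_mult'[OF m(2) r] homog_mult'[OF m(3) r] homog_mult'[OF r \<sigma>] by auto
  then show "clifford_pure W (m * r) \<sigma> = clifford_pure W m (r * \<sigma>)"
    unfolding eq unfolding m(1) using n m(2,3) \<sigma>
    by (elim disjE; simp add: clifford_pure_minus clifford_pure_plus) (simp_all add: mult.assoc)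
qed

section \<open>A partition of unity and the covariant derivative\<close>

definition unit_left :: "int \<Rightarrow> bool \<Rightarrow> 'w" where
  "unit_left n k = (if n = 1 then if k then gd else - qs 1 gb else if k then ga else - qs (- 1) gc)"

definition unit_right :: "int \<Rightarrow> bool \<Rightarrow> 'w" where
  "unit_right n k = (if n = 1 then if k then ga else gc else if k then gd else gb)"

lemma unit_mem:
  assumes "n = 1 \<or> n = - 1"
  shows "unit_left n k \<in> homog W (- n)" "unit_right n k \<in> homog W n"
  using assms homog_gens by (auto simp: unit_left_def unit_right_def intro!: homog_uminus homog_qs)

text \<open>For \<open>n = 1\<close> this is \<open>da - q bc = 1\<close>, otherwise
  \<open>ad - q^-1 cb = 1\<close>: the two determinant relations, with coefficients coming from the
  antipode.\<close>

lemma unit_sum: "(\<Sum>k\<in>UNIV. unit_left n k * unit_right n k) = 1"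
  by (simp add: UNIV_bool unit_left_def unit_right_def normal_simps)

text \<open>An explicit section of the multiplication map, splitting a form by the partition of
  unity.\<close>

definition tensor_rep :: "int \<Rightarrow> 'w \<Rightarrow> ('w \<times> 'w \<Rightarrow>\<^sub>0 int)" where
  "tensor_rep n \<xi> = (\<Sum>k\<in>UNIV. frag_of (\<xi> * unit_left n k, unit_right n k))"

abbreviation spinor_tclass :: "int \<Rightarrow> ('w \<times> 'w \<Rightarrow>\<^sub>0 int) \<Rightarrow> ('w \<times> 'w \<Rightarrow>\<^sub>0 int) set" where
  "spinor_tclass n \<equiv> tclass (sphere1 W) (homog W 0) (homog W n)"

context
  fixes n :: int
  assumes n: "n = 1 \<or> n = - 1"
begin

lemma feval_tensor_rep: "feval (*) (tensor_rep n \<xi>) = \<xi>"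
  using unit_sum[of n]
  by (simp add: tensor_rep_def feval_sum mult.assoc flip: sum_distrib_left)

lemma keys_tensor_rep:
  assumes "x \<in> homog W (n - 2)" "y \<in> homog W (n + 2)"
  shows "Poly_Mapping.keys (tensor_rep n (x * ep + y * em)) \<subseteq> sphere1 W \<times> homog W n"
  unfolding tensor_rep_def
  using form1_mult_sphere1[OF assms] unit_mem[OF n] by (intro order_trans[OF keys_sum]) auto

text \<open>This amounts to injectivity of the multiplication map on the tensor product.\<close>

lemma spinor_tclass_rep:
  assumes "Poly_Mapping.keys s \<subseteq> sphere1 W \<times> homog W n"
  shows "spinor_tclass n s = spinor_tclass n (tensor_rep n (feval (*) s))"
  unfolding tensor_rep_def
proof (rule tclass_normal_form[OF _ unit_sum _ _ _ _ _ _ _ _ assms])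
  show "r * \<sigma> \<in> homog W n" if "r \<in> homog W 0" "\<sigma> \<in> homog W n" for r \<sigma>
    using homog_mult'[OF that] by simp
  show "\<sigma> * unit_left n k \<in> homog W 0" if "\<sigma> \<in> homog W n" for \<sigma> k
    using homog_mult'[OF that unit_mem(1)[OF n]] by simp
qed (auto simp: unit_mem[OF n] sphere1_zero intro: homog_add sphere1_diff sphere1_mult)

text \<open>The connection term cancels the \<open>e0\<close> part of \<open>dif W \<sigma>\<close>.
  What is left has \<open>tensor_rep\<close> as a preimage, and injectivity of multiplication makes
  its class the only one.\<close>

lemma is_cov_deriv_iff:
  assumes \<sigma>: "\<sigma> \<in> homog W n"
  shows "is_cov_deriv q W n \<sigma> t \<longleftrightarrow> t = spinor_tclass n (tensor_rep n (dp \<sigma> * ep + dm \<sigma> * em))"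
proof -
  note keys = keys_tensor_rep[OF dp_homog[OF \<sigma>] dm_homog[OF \<sigma>]]
  show ?thesis
  proof
    assume t: "is_cov_deriv q W n \<sigma> t"
    then obtain s where s: "t = spinor_tclass n s" "Poly_Mapping.keys s \<subseteq> sphere1 W \<times> homog W n"
      by (auto simp: is_cov_deriv_def tensor_def)
    with t have "feval (*) s = dp \<sigma> * ep + dm \<sigma> * em"
      by (simp add: is_cov_deriv_def tlift_times_tclass dif_homog[OF \<sigma>])
    then show "t = spinor_tclass n (tensor_rep n (dp \<sigma> * ep + dm \<sigma> * em))"
      using s spinor_tclass_rep by metis
  next
    assume "t = spinor_tclass n (tensor_rep n (dp \<sigma> * ep + dm \<sigma> * em))"
    then show "is_cov_deriv q W n \<sigma> t"
      using keys by (simp add: is_cov_deriv_def tlift_times_tclass dif_homog[OF \<sigma>] feval_tensor_rep tensor_def)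
  qed
qed

lemma cov_deriv_eq:
  "\<sigma> \<in> homog W n \<Longrightarrow>
    cov_deriv q W n \<sigma> = spinor_tclass n (tensor_rep n (dp \<sigma> * ep + dm \<sigma> * em))"
  by (simp add: cov_deriv_def is_cov_deriv_iff)

text \<open>Moving \<open>ep\<close> or \<open>em\<close> past \<open>unit_left n k\<close>, of
  degree \<open>- n\<close>, costs \<open>q powi (- n)\<close>; the remaining products sum to
  1.\<close>

lemma clifford_tensor_rep:
  assumes x: "x \<in> homog W (n - 2)" and y: "y \<in> homog W (n + 2)"
  shows "clifford W (spinor_tclass n (tensor_rep n (x * ep + y * em)))
    = (if n = 1 then qs (- 1) x else qs 1 y)"
proof -
  have "clifford_pure W ((x * ep + y * em) * unit_left n k) (unit_right n k)
      = (if n = 1 then qs (- 1) x else qs 1 y) * (unit_left n k * unit_right n k)" for k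
  proof -
    note u = unit_mem[OF n, of k]
    have "qs (- n) (x * unit_left n k) \<in> homog W (- 2)" "qs (- n) (y * unit_left n k) \<in> homog W 2"
      by (intro homog_qs homog_mult'[OF x u(1)] homog_mult'[OF y u(1)]; simp)+
    then show ?thesis
      unfolding form1_mult_right[OF u(1)] using n u(2)
      by (elim disjE; simp add: clifford_pure_minus clifford_pure_plus) (simp_all add: qs_simps mult.assoc)
  qed
  then show ?thesis
    unfolding clifford_tclass[OF n keys_tensor_rep[OF x y]]
    using unit_sum[of n] by (simp add: tensor_rep_def feval_sum flip: sum_distrib_left)
qed

text \<open>The projections are right linear over functions, so they descend to the tensor product,
  and on representatives they simply drop one coefficient.\<close>

lemma tmap_left_proj:
  assumes x: "x \<in> homog W (n - 2)" and y: "y \<in> homog W (n + 2)"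
  shows "tmap_left (sphere1 W) (homog W 0) (homog W n) (proj10 W)
      (spinor_tclass n (tensor_rep n (x * ep + y * em)))
      = spinor_tclass n (tensor_rep n (x * ep + 0 * em))" (is ?A)
    and "tmap_left (sphere1 W) (homog W 0) (homog W n) (proj01 W)
      (spinor_tclass n (tensor_rep n (x * ep + y * em)))
      = spinor_tclass n (tensor_rep n (0 * ep + y * em))" (is ?B)
proof -
  have add: "proj10 W (m + m') = proj10 W m + proj10 W m'" "proj01 W (m + m') = proj01 W m + proj01 W m'"
    if "m \<in> sphere1 W" "m' \<in> sphere1 W" for m m'
  proof -
    from that obtain f g f' g' where m: "m = f * ep + g * em" "f \<in> homog W (- 2)" "g \<in> homog W 2"
      and m': "m' = f' * ep + g' * em" "f' \<in> homog W (- 2)" "g' \<in> homog W 2"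
      by (elim sphere1E)
    have eq: "m + m' = (f + f') * ep + (g + g') * em" by (simp add: m m' distrib_right)
    show "proj10 W (m + m') = proj10 W m + proj10 W m'" "proj01 W (m + m') = proj01 W m + proj01 W m'"
      unfolding eq unfolding m(1) m'(1) using m(2,3) m'(2,3)
      by (simp_all add: proj_eq homog_add) (simp_all add: distrib_right)
  qed
  have mult: "proj10 W (m * r) = proj10 W m * r" "proj01 W (m * r) = proj01 W m * r"
    if "m \<in> sphere1 W" and r: "r \<in> homog W 0" for m r
  proof -
    from that obtain f g where m: "m = f * ep + g * em" "f \<in> homog W (- 2)" "g \<in> homog W 2"
      by (elim sphere1E)
    have "f * r \<in> homog W (- 2)" "g * r \<in> homog W 2"
      using homog_mult'[OF m(2) r] homog_mult'[OF m(3) r] by auto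
    then show "proj10 W (m * r) = proj10 W m * r" "proj01 W (m * r) = proj01 W m * r"
      using form1_mult_right[OF r, of f g] form1_mult_right[OF r, of f 0] form1_mult_right[OF r, of 0 g]
      by (simp_all add: m proj_eq qs_simps)
  qed
  have mem: "proj10 W m \<in> sphere1 W" "proj01 W m \<in> sphere1 W" if "m \<in> sphere1 W" for m
    using that sphere1I[of _ 0] sphere1I[of 0] by (auto elim!: sphere1E simp: proj_eq)
  have proj: "proj10 W ((x * ep + y * em) * unit_left n k) = (x * ep) * unit_left n k"
    "proj01 W ((x * ep + y * em) * unit_left n k) = (y * em) * unit_left n k" for k
  proof -
    note u = unit_mem[OF n, of k]
    have "qs (- n) (x * unit_left n k) \<in> homog W (- 2)" "qs (- n) (y * unit_left n k) \<in> homog W 2"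
      by (intro homog_qs homog_mult'[OF x u(1)] homog_mult'[OF y u(1)]; simp)+
    moreover have "(x * ep) * unit_left n k = qs (- n) (x * unit_left n k) * ep"
      "(y * em) * unit_left n k = qs (- n) (y * unit_left n k) * em"
      using form1_mult_right[OF u(1), of x 0] form1_mult_right[OF u(1), of 0 y]
      by (simp_all add: qs_simps(8))
    ultimately show "proj10 W ((x * ep + y * em) * unit_left n k) = (x * ep) * unit_left n k"
      "proj01 W ((x * ep + y * em) * unit_left n k) = (y * em) * unit_left n k"
      unfolding form1_mult_right[OF u(1)] by (simp_all add: proj_eq)
  qed
  have fmap2: "fmap2 p id (tensor_rep n \<xi>) = (\<Sum>k\<in>UNIV. frag_of (p (\<xi> * unit_left n k), unit_right n k))"
    for p \<xi>
    by (simp add: tensor_rep_def UNIV_bool fmap2_add)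
  show ?A ?B
    by (subst tmap_left_tclass; (simp add: add mult mem keys_tensor_rep[OF x y])?;
        simp add: fmap2 proj; simp add: tensor_rep_def)+
qed

end

text \<open>From here on the operator is handled through \<open>dp\<close> and \<open>dm\<close>,
  without tensors.\<close>

lemma dirac_eq:
  assumes \<sigma>: "\<sigma> \<in> homog W 1" and \<tau>: "\<tau> \<in> homog W (- 1)"
  shows "dirac q W (\<sigma> + \<tau>) = qs (- 1) (dp \<sigma>) + qs 1 (dm \<tau>)"
proof -
  have "clifford W (cov_deriv q W 1 \<sigma>) + clifford W (cov_deriv q W (- 1) \<tau>)
      = qs (- 1) (dp \<sigma>) + qs 1 (dm \<tau>)"
    using dp_homog[OF \<sigma>] dm_homog[OF \<sigma>] dp_homog[OF \<tau>] dm_homog[OF \<tau>]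
    by (simp add: cov_deriv_eq \<sigma> \<tau> clifford_tensor_rep)
  note eq = this[symmetric]
  show ?thesis
    unfolding dirac_def spinor_minus_def spinor_plus_def eq
    by (rule the_equality) (use \<sigma> \<tau> spinor_unique[OF \<sigma> \<tau>] in blast)+
qed

lemma dirac_minus: "\<sigma> \<in> homog W 1 \<Longrightarrow> dirac q W \<sigma> = qs (- 1) (dp \<sigma>)"
  using dirac_eq[of \<sigma> 0] dpm_linear(4)[of 0 0] by (simp add: qs_simps)

lemma dirac_plus: "\<tau> \<in> homog W (- 1) \<Longrightarrow> dirac q W \<tau> = qs 1 (dm \<tau>)"
  using dirac_eq[of 0 \<tau>] dpm_linear(3)[of 0 0] by (simp add: qs_simps)

section \<open>The Laplacian and the square of the Dirac operator\<close>

lemma hodge_eq: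
  assumes "f \<in> homog W 0" "g \<in> homog W (- 2)" "h \<in> homog W 2" "k \<in> homog W 0"
  shows "hodge W (f + g * ep + h * em + k * (ep * em)) = f * (ep * em) + g * ep - h * em + k"
proof -
  have uniq: "f = f' \<and> g = g' \<and> h = h' \<and> k = k'"
    if "f' \<in> homog W 0" "g' \<in> homog W (- 2)" "h' \<in> homog W 2" "k' \<in> homog W 0"
      "f + g * ep + h * em + k * (ep * em) = f' + g' * ep + h' * em + k' * (ep * em)" for f' g' h' k'
    using ext_unique[of f g h k 0 0 f' g' h' k' 0 0] that assms homog_subset_qsl2
      vs.subspace_0[OF qsl2_subspace] by auto
  show ?thesis
    unfolding hodge_def vol_def
    by (rule the_equality) (use assms uniq in blast)+
qed

text \<open>The two \<open>ep * e0\<close> terms, from \<open>dif W g\<close> and from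
  \<open>dif W ep\<close>, cancel by the value of the q-integer at -2.\<close>

lemma dif_forms10:
  assumes "g \<in> homog W (- 2)"
  shows "dif W (g * ep) = - (qs 2 (dm g) * (ep * em))"
proof -
  have "q_int (q\<^sup>2) (- 2) = inverse (q\<^sup>2) * q_int (q\<^sup>2) (- 1) + q_int (q\<^sup>2) (- 1)"
    using q_int_add[of "q\<^sup>2" "- 1" "- 1"] q_nonzero by (simp add: power_int_minus)
  also have "\<dots> = - (q powi (- 2) + q powi (- 4))"
    using q_nonzero by (simp add: q_int_minus_one power_int_minus field_simps eval_nat_numeral)
  finally have r: "q_int (q\<^sup>2) (- 2) = - (q powi (- 2) + q powi (- 4))" .
  have c: "q_int (q\<^sup>2) (- 2) * q powi 4 = - (q\<^sup>2 * (1 + q powi (- 2)))"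
    unfolding r using q_nonzero by (simp add: power_int_minus field_simps eval_nat_numeral power_int_numeral)
  have "dif W (g * ep) = - (qs 2 (dm g) * (ep * em))
      - (q_int (q\<^sup>2) (- 2) * q powi 4) \<cdot> (g * (ep * e0)) - (q\<^sup>2 * (1 + q powi (- 2))) \<cdot> (g * (ep * e0))"
    by (simp add: dif_mult[OF assms] dif_homog[OF assms] dif_ep distrib_right mult.assoc wedge_rules
        smult_mult_left smult_mult_right qs_def)
  then show ?thesis unfolding c by simp
qed

text \<open>As for type (1,0), the \<open>em * e0\<close> terms cancel, now by the value of the
  q-integer at 2.\<close>

lemma dif_forms01:
  assumes "h \<in> homog W 2"
  shows "dif W (h * em) = dp h * (ep * em)"
proof -
  have "q_int (q\<^sup>2) 2 = 1 + q\<^sup>2"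
    using q_int_add[of "q\<^sup>2" 1 1] q_nonzero by simp
  then have c: "q_int (q\<^sup>2) 2 * q powi (- 4) = q powi (- 2) * (1 + q powi (- 2))"
    using q_nonzero by (simp add: power_int_minus field_simps eval_nat_numeral power_int_numeral)
  have "dif W (h * em) = dp h * (ep * em)
      - (q_int (q\<^sup>2) 2 * q powi (- 4)) \<cdot> (h * (em * e0)) + (q powi (- 2) * (1 + q powi (- 2))) \<cdot> (h * (em * e0))"
    by (simp add: dif_mult[OF assms] dif_homog[OF assms] dif_em distrib_right mult.assoc wedge_rules
        smult_mult_left smult_mult_right)
  then show ?thesis unfolding c by simp
qed

text \<open>The first identity is \<open>dif W (dif W f) = 0\<close> read off at
  \<open>ep * em\<close>. It makes the two terms of the Laplacian equal, and the factor 1/2 averages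
  them.\<close>

lemma
  assumes f: "f \<in> homog W 0"
  shows dp_dm: "dp (dm f) = qs 2 (dm (dp f))"
    and laplacian_eq: "laplacian W f = qs 2 (dm (dp f))"
proof -
  have p: "dp f \<in> homog W (- 2)" and m: "dm f \<in> homog W 2"
    using dp_homog[OF f] dm_homog[OF f] by simp_all
  have pm: "dp (dm f) \<in> homog W 0" and mp: "qs 2 (dm (dp f)) \<in> homog W 0"
    using dp_homog[OF m] dm_homog[OF p] by (simp_all add: homog_qs)
  have "(dp (dm f) - qs 2 (dm (dp f))) * (ep * em) = dif W (dif W f)"
    by (simp add: dif_sphere[OF f] dif_add dif_forms10[OF p] dif_forms01[OF m] left_diff_distrib)
  then have "(dp (dm f) - qs 2 (dm (dp f))) * (ep * em) = 0"
    by (simp add: dif_dif)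
  then have "0 = (0::'w) \<and> 0 = (0::'w) \<and> 0 = (0::'w) \<and> dp (dm f) - qs 2 (dm (dp f)) = 0 \<and> 0 = (0::'w) \<and> 0 = (0::'w)"
    by (intro ext_unique)
      (use homog_diff[OF pm mp] homog_subset_qsl2 vs.subspace_0[OF qsl2_subspace] in auto)
  then show eq: "dp (dm f) = qs 2 (dm (dp f))" by simp
  have "hodge W (dif W f) = dp f * ep - dm f * em"
    using hodge_eq[OF homog_zero p m homog_zero] by (simp add: dif_sphere[OF f])
  moreover have "dif W (dp f * ep - dm f * em) = 0 + 0 * ep + 0 * em + (- qs 2 (dm (dp f)) - dp (dm f)) * (ep * em)"
    using dif_add[of "dp f * ep - dm f * em" "dm f * em"]
    by (simp add: dif_forms10[OF p] dif_forms01[OF m] left_diff_distrib algebra_simps)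
  ultimately have "laplacian W f = (- 1 / 2) \<cdot> (- qs 2 (dm (dp f)) - dp (dm f))"
    using hodge_eq[OF homog_zero homog_zero homog_zero homog_diff[OF homog_uminus[OF mp] pm]]
    by (simp add: laplacian_def)
  also have "\<dots> = (1 / 2) \<cdot> qs 2 (dm (dp f)) + (1 / 2) \<cdot> qs 2 (dm (dp f))"
    by (simp add: eq vs.scale_right_diff_distrib)
  also have "\<dots> = qs 2 (dm (dp f))"
    by (simp flip: vs.scale_left_distrib)
  finally show "laplacian W f = qs 2 (dm (dp f))" .
qed

section \<open>The square of the Dirac operator by the Leibniz rule\<close>

lemma dpm_qs: "dp (qs n x) = qs n (dp x)" "dm (qs n x) = qs n (dm x)"
  by (simp_all add: qs_def dpm_linear)

text \<open>The factors \<open>q^-1\<close> and \<open>q\<close> of the two steps cancel, so the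
  square is \<open>dm\<close> after \<open>dp\<close>. Two Leibniz rules give the Laplacian with
  factor 1.\<close>

lemma dirac_square_minus:
  assumes f: "f \<in> homog W 0" and \<sigma>: "\<sigma> \<in> homog W 1" and "dm \<sigma> = 0"
  shows "dirac q W (dirac q W (f * \<sigma>)) = laplacian W f * \<sigma> + qs (- 1) (dm f * dp \<sigma>) + f * dm (dp \<sigma>)"
proof -
  have p: "dp f \<in> homog W (- 2)" and s: "dp \<sigma> \<in> homog W (- 1)" and fs: "f * \<sigma> \<in> homog W 1"
    using dp_homog[OF f] dp_homog[OF \<sigma>] homog_mult[OF f \<sigma>] by simp_all
  have "dp (f * \<sigma>) \<in> homog W (- 1)" using dp_homog[OF fs] by simp
  then have "dirac q W (dirac q W (f * \<sigma>)) = dm (dp (f * \<sigma>))"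
    by (simp add: dirac_minus[OF fs] dirac_plus homog_qs dpm_qs qs_simps)
  then show ?thesis
    by (simp add: dp_mult[OF f \<sigma>] dpm_linear dpm_qs
        dm_mult[OF p \<sigma>] dm_mult[OF f s] assms(3) laplacian_eq[OF f] scale_qs qs_simps)
qed

text \<open>Here the square is \<open>dp\<close> after \<open>dm\<close>; both Leibniz twists are
  \<open>q^-1\<close> on the term differentiating \<open>f\<close> twice, whence the factor
  \<open>q^-2\<close>.\<close>

lemma dirac_square_plus:
  assumes f: "f \<in> homog W 0" and \<tau>: "\<tau> \<in> homog W (- 1)" and "dp \<tau> = 0"
  shows "dirac q W (dirac q W (f * \<tau>)) =
    qs (- 2) (laplacian W f * \<tau>) + qs 1 (dp f * dm \<tau>) + f * dp (dm \<tau>)"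
proof -
  have m: "dm f \<in> homog W 2" and t: "dm \<tau> \<in> homog W 1" and ft: "f * \<tau> \<in> homog W (- 1)"
    using dm_homog[OF f] dm_homog[OF \<tau>] homog_mult[OF f \<tau>] by simp_all
  have "dm (f * \<tau>) \<in> homog W 1" using dm_homog[OF ft] by simp
  then have "dirac q W (dirac q W (f * \<tau>)) = dp (dm (f * \<tau>))"
    by (simp add: dirac_minus dirac_plus[OF ft] homog_qs dpm_qs qs_simps)
  then show ?thesis
    by (simp add: dm_mult[OF f \<tau>] dpm_linear dpm_qs
        dp_mult[OF m \<tau>] dp_mult[OF f t] assms(3) laplacian_eq[OF f] dp_dm[OF f] scale_qs qs_simps)
qed

section \<open>Explicit values on the coordinates of the sphere\<close>

lemma dpm_one: "dp 1 = 0" "dm 1 = 0"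
  using dp_mult[OF homog_one homog_one] dm_mult[OF homog_one homog_one] by simp_all

lemma sphere_laplacians:
  "laplacian W (ga * gb) = qs 1 (ga * gb) + qs 2 (gb * ga)"
  "laplacian W (gb * gc) = qs 2 (ga * gd) + qs 3 (gb * gc)"
  "laplacian W (gc * gd) = qs 1 (gc * gd) + qs 2 (gd * gc)"
  by (simp_all add: laplacian_eq gens_homog2 homog_gens dpm_sphere_gens dpm_qs dpm_gens
      dm_mult[OF homog_gens(2,2)] dm_mult[OF homog_gens(2,4)] dm_mult[OF homog_gens(4,4)]
      scale_qs qs_simps)

lemma laplacian_linear:
  "f \<in> homog W 0 \<Longrightarrow> laplacian W (1 + z \<cdot> f) = z \<cdot> laplacian W f"
  by (simp add: laplacian_eq homog_add homog_smult homog_one dpm_linear dpm_one qs_def scale_simps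
      vs.scale_left_commute)

text \<open>The last summands reflect that every generator is an eigenvector of the squared operator
  with eigenvalue \<open>q\<close>.\<close>

lemma dirac_square_gens:
  assumes f: "f \<in> homog W 0"
  shows "dirac q W (dirac q W (f * ga)) = laplacian W f * ga + dm f * gb + qs 1 (f * ga)"
    "dirac q W (dirac q W (f * gb)) = qs (- 2) (laplacian W f * gb) + qs 1 (dp f * ga) + qs 1 (f * gb)"
    "dirac q W (dirac q W (f * gc)) = laplacian W f * gc + dm f * gd + qs 1 (f * gc)"
    "dirac q W (dirac q W (f * gd)) = qs (- 2) (laplacian W f * gd) + qs 1 (dp f * gc) + qs 1 (f * gd)"
  using homog_gens
  by (simp_all add: dirac_square_minus[OF f] dirac_square_plus[OF f] dpm_gens dpm_linear scale_qs
      qs_simps dpm_qs)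

lemma dirac_square_formulas:
  defines "m \<equiv> 1 + (q + inverse q) \<cdot> (gb * gc)" and "k \<equiv> inverse q * (q + inverse q)"
  shows
    "dirac q W (dirac q W (ga * gb * ga)) = k \<cdot> (laplacian W (ga * gb) * ga)"
    "dirac q W (dirac q W (m * ga)) = k \<cdot> (laplacian W m * ga) - inverse q \<cdot> ga"
    "dirac q W (dirac q W (gc * gd * ga)) = k \<cdot> (laplacian W (gc * gd) * ga) - inverse q \<cdot> gc"
    "dirac q W (dirac q W (ga * gb * gb)) = k \<cdot> (laplacian W (ga * gb) * gb)"
    "dirac q W (dirac q W (m * gb)) = k \<cdot> (laplacian W m * gb) + q \<cdot> gb"
    "dirac q W (dirac q W (gc * gd * gb)) = k \<cdot> (laplacian W (gc * gd) * gb) + q \<cdot> gd"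
    "dirac q W (dirac q W (ga * gb * gc)) = k \<cdot> (laplacian W (ga * gb) * gc) + ga"
    "dirac q W (dirac q W (m * gc)) = k \<cdot> (laplacian W m * gc) + q \<cdot> gc"
    "dirac q W (dirac q W (gc * gd * gc)) = k \<cdot> (laplacian W (gc * gd) * gc)"
    "dirac q W (dirac q W (ga * gb * gd)) = k \<cdot> (laplacian W (ga * gb) * gd) - q\<^sup>2 \<cdot> gb"
    "dirac q W (dirac q W (m * gd)) = k \<cdot> (laplacian W m * gd) - q ^ 3 \<cdot> gd"
    "dirac q W (dirac q W (gc * gd * gd)) = k \<cdot> (laplacian W (gc * gd) * gd)"
proof -
  have H: "ga * gb \<in> homog W 0" "gb * gc \<in> homog W 0" "gc * gd \<in> homog W 0" "m \<in> homog W 0"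
    by (simp_all add: m_def gens_homog2 homog_gens homog_add homog_smult homog_one)
  have m: "laplacian W m = (q + inverse q) \<cdot> (qs 2 (ga * gd) + qs 3 (gb * gc))"
    "dp m = (q + inverse q) \<cdot> qs 1 (gb * gd)" "dm m = (q + inverse q) \<cdot> qs 1 (ga * gc)"
    by (simp_all add: m_def laplacian_linear[OF H(2)] sphere_laplacians dpm_linear dpm_one dpm_sphere_gens)
  note square = H[THEN dirac_square_gens(1)] H[THEN dirac_square_gens(2)]
    H[THEN dirac_square_gens(3)] H[THEN dirac_square_gens(4)] dpm_sphere_gens m sphere_laplacians
  show
    "dirac q W (dirac q W (ga * gb * ga)) = k \<cdot> (laplacian W (ga * gb) * ga)"
    "dirac q W (dirac q W (m * ga)) = k \<cdot> (laplacian W m * ga) - inverse q \<cdot> ga"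
    "dirac q W (dirac q W (gc * gd * ga)) = k \<cdot> (laplacian W (gc * gd) * ga) - inverse q \<cdot> gc"
    "dirac q W (dirac q W (ga * gb * gb)) = k \<cdot> (laplacian W (ga * gb) * gb)"
    "dirac q W (dirac q W (m * gb)) = k \<cdot> (laplacian W m * gb) + q \<cdot> gb"
    "dirac q W (dirac q W (gc * gd * gb)) = k \<cdot> (laplacian W (gc * gd) * gb) + q \<cdot> gd"
    "dirac q W (dirac q W (ga * gb * gc)) = k \<cdot> (laplacian W (ga * gb) * gc) + ga"
    "dirac q W (dirac q W (m * gc)) = k \<cdot> (laplacian W m * gc) + q \<cdot> gc"
    "dirac q W (dirac q W (gc * gd * gc)) = k \<cdot> (laplacian W (gc * gd) * gc)"
    "dirac q W (dirac q W (ga * gb * gd)) = k \<cdot> (laplacian W (ga * gb) * gd) - q\<^sup>2 \<cdot> gb"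
    "dirac q W (dirac q W (m * gd)) = k \<cdot> (laplacian W m * gd) - q ^ 3 \<cdot> gd"
    "dirac q W (dirac q W (gc * gd * gd)) = k \<cdot> (laplacian W (gc * gd) * gd)"
    \<comment> \<open>\<open>m\<close> stays folded until its derivatives are inserted. As
      \<open>k = 1 + q^-2\<close>, the terms beside the Laplacian must supply its missing multiple,
      \<open>q^-2\<close> for \<open>ga\<close> and \<open>gc\<close> and 1 for \<open>gb\<close>
      and \<open>gd\<close>, plus the remainder; rewriting to monomials checks this.\<close>
    unfolding square unfolding m_def k_def
    by (simp_all add: normal_simps)
qed

section \<open>Covariance\<close>

lemma coact_mem_iff:
  assumes "u \<in> coact W x"
  shows "v \<in> coact W x \<longleftrightarrow>
    Poly_Mapping.keys v \<subseteq> qsl2 W \<times> UNIV \<and> v - u \<in> tnull (qsl2 W) (scalars W) UNIV"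
  using tensor_mem_iff[OF coact_tensor assms] .

lemma coact_keys: "u \<in> coact W x \<Longrightarrow> Poly_Mapping.keys u \<subseteq> qsl2 W \<times> UNIV"
  using coact_mem_iff by blast

text \<open>Only scalars are moved across this tensor product, so complex linearity suffices for
  balancedness.\<close>

lemma fmap2_linear_tnull:
  assumes "u \<in> tnull M (scalars W) UNIV"
    and add: "\<And>x y. L (x + y) = L x + L y" and scale: "\<And>z x. L (z \<cdot> x) = z \<cdot> L x"
  shows "fmap2 id L u \<in> tnull M (scalars W) UNIV"
  using assms(1)
proof induction
  case (balanced m r n)
  then obtain z where "r = z \<cdot> 1" by (auto simp: scalars_def)
  with balanced show ?case
    using tnull.balanced[of m M r "scalars W" "L n" UNIV]
    by (simp add: fmap2_diff smult_mult_left scale)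
qed (auto simp: fmap2_diff add intro: tnull.intros)

text \<open>Multiplicativity applied to \<open>z \<cdot> 1\<close> puts the scalar into the left
  factor, and balancing carries it to the right.\<close>

lemma coact_smult:
  assumes u: "u \<in> coact W x"
  shows "fmap2 id (smult W z) u \<in> coact W (z \<cdot> x)"
proof -
  let ?u' = "fprod (frag_of (z \<cdot> 1, 1)) u"
  have u': "?u' \<in> coact W (z \<cdot> x)"
    using coact_mult[OF coact_scalar u] by (simp add: smult_mult_left)
  have z: "z \<cdot> 1 \<in> scalars W" by (simp add: scalars_def)
  have "?u' - fmap2 id (smult W z) u \<in> tnull (qsl2 W) (scalars W) UNIV"
    using coact_keys[OF u]
  proof (induction u rule: frag_induction)
    case zero
    show ?case by (simp add: fprod_def tnull.zero)
  next
    case (one mn)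
    then obtain m n where "mn = (m, n)" "m \<in> qsl2 W" by auto
    then show ?case
      using tnull.balanced[OF _ z, of m "qsl2 W" n UNIV]
      by (simp add: fprod_def smult_mult_left smult_mult_right)
  next
    case (diff a b)
    then show ?case
      using tnull.diff[OF diff]
      by (simp add: fprod_def frag_extend_diff fmap2_diff algebra_simps)
  qed
  then have "fmap2 id (smult W z) u - ?u' \<in> tnull (qsl2 W) (scalars W) UNIV"
    using tnull_uminus by fastforce
  moreover have "Poly_Mapping.keys (fmap2 id (smult W z) u) \<subseteq> qsl2 W \<times> UNIV"
    using keys_fmap2[of id "smult W z" u] coact_keys[OF u] by force
  ultimately show ?thesis
    using coact_mem_iff[OF u'] by blast
qed

lemma qsl2_mult:
  assumes "x \<in> qsl2 W" "y \<in> qsl2 W"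
  shows "x * y \<in> qsl2 W"
proof -
  note mem = vs.subspace_0[OF qsl2_subspace] vs.subspace_add[OF qsl2_subspace]
    vs.subspace_scale[OF qsl2_subspace]
  have word: "word_val W v * y \<in> qsl2 W" for v
    using assms(2)[unfolded qsl2_def]
  proof (induction rule: vs.span_induct_alt)
    case base
    then show ?case by (simp add: mem)
  next
    case (step z w y)
    then obtain w' where "w = word_val W w'" by auto
    then have "word_val W v * w \<in> qsl2 W"
      unfolding qsl2_def by (auto intro!: vs.span_base simp flip: word_val_plus)
    with step show ?case by (simp add: distrib_left smult_mult_right mem)
  qed
  show ?thesis
    using assms(1)[unfolded qsl2_def]
  proof (induction rule: vs.span_induct_alt)
    case base
    then show ?case by (simp add: mem)
  next
    case (step z w x)
    then show ?case using word by (auto simp: distrib_right smult_mult_left mem)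
  qed
qed

lemma keys_fprod_homog:
  assumes "Poly_Mapping.keys u \<subseteq> qsl2 W \<times> homog W m" "Poly_Mapping.keys v \<subseteq> qsl2 W \<times> homog W n"
  shows "Poly_Mapping.keys (fprod u v) \<subseteq> qsl2 W \<times> homog W (m + n)"
  using keys_fprod[of u v] assms by (force intro: qsl2_mult homog_mult)

text \<open>In the coproduct of each generator both right factors have the degree of that generator,
  and products of representatives add degrees.\<close>

lemma coact_word: "\<exists>u\<in>coact W (word_val W w). Poly_Mapping.keys u \<subseteq> qsl2 W \<times> homog W (word_deg w)"
proof (cases w)
  case (QWord gs)
  have two: "Poly_Mapping.keys (frag_of (gen W g, gen W h) + frag_of (gen W g', gen W h'))
      \<subseteq> qsl2 W \<times> homog W n" if "gen_deg h = n" "gen_deg h' = n" for g h g' h' n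
    using that homog_gen[of g] homog_gen[of g'] homog_gen[of h] homog_gen[of h'] homog_subset_qsl2
    by (intro order_trans[OF keys_add]) auto
  have gen: "\<exists>u\<in>coact W (gen W g). Poly_Mapping.keys u \<subseteq> qsl2 W \<times> homog W (gen_deg g)" for g
    by (cases g; simp only:; rule bexI[OF _ coact_a] bexI[OF _ coact_b]
        bexI[OF _ coact_c] bexI[OF _ coact_d]; rule two; simp)
  have "\<exists>u\<in>coact W (word_val W (QWord gs)). Poly_Mapping.keys u \<subseteq> qsl2 W \<times> homog W (word_deg (QWord gs))"
  proof (induction gs)
    case Nil
    show ?case
      using coact_scalar[of 1] homog_one homog_subset_qsl2[of 0]
      by (auto simp: word_val_def word_deg_def intro!: bexI[of _ "frag_of (1, 1)"])
  next
    case (Cons g gs)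
    then obtain v where v: "v \<in> coact W (word_val W (QWord gs))"
      "Poly_Mapping.keys v \<subseteq> qsl2 W \<times> homog W (word_deg (QWord gs))" by auto
    obtain u where u: "u \<in> coact W (gen W g)" "Poly_Mapping.keys u \<subseteq> qsl2 W \<times> homog W (gen_deg g)"
      using gen by blast
    show ?case
      using coact_mult[OF u(1) v(1)] keys_fprod_homog[OF u(2) v(2)]
      by (auto simp: word_val_def word_deg_def)
  qed
  with QWord show ?thesis by simp
qed

lemma coact_homog:
  "x \<in> homog W n \<Longrightarrow> \<exists>u\<in>coact W x. Poly_Mapping.keys u \<subseteq> qsl2 W \<times> homog W n"
proof (induction rule: homog_induct)
  case zero
  \<comment> \<open>Scaling by 0 replaces the right factor 1, of degree zero, by 0, which has every
    degree.\<close>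
  have "frag_of (0, 0) \<in> coact W 0"
    using coact_smult[OF coact_scalar[of 0], of 0] by simp
  then show ?case
    using homog_zero homog_subset_qsl2[of 0] by (intro bexI[of _ "frag_of (0, 0)"]) auto
next
  case (add z w x)
  then obtain u where u: "u \<in> coact W x" "Poly_Mapping.keys u \<subseteq> qsl2 W \<times> homog W n" by auto
  obtain v where v: "v \<in> coact W (word_val W w)" "Poly_Mapping.keys v \<subseteq> qsl2 W \<times> homog W n"
    using coact_word[of w] add by auto
  have "Poly_Mapping.keys (fmap2 id (smult W z) v) \<subseteq> qsl2 W \<times> homog W n"
    using keys_fmap2[of id "smult W z" v] v(2) by (force intro: homog_smult)
  then show ?case
    using coact_add[OF coact_smult[OF v(1), of z] u(1)] u(2)
      keys_add[of "fmap2 id (smult W z) v" u] by blast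
qed

text \<open>Coefficients of forms can be extracted by a linear map on the right tensor factor, which is
  well defined on the tensor product over the scalars.\<close>

lemma coact_top_coeff:
  assumes u: "u \<in> coact W x" and e: "frag_of (1, e) \<in> coact W e"
    and y: "y \<in> homog W n" and eq: "dif W x * e = y * (ep * em * e0)"
  shows "fmap2 id (\<lambda>x. top_coeff (dif W x * e)) u \<in> coact W y"
proof -
  interpret l: Vector_Spaces.linear "smult W" "smult W" top_coeff by (rule top_coeff)
  obtain v where v: "v \<in> coact W y" "Poly_Mapping.keys v \<subseteq> qsl2 W \<times> homog W n"
    using coact_homog[OF y] by auto
  have "frag_of (1, ep * em * e0) \<in> coact W (ep * em * e0)"
    using coact_mult[OF coact_mult[OF coact_frm coact_frm] coact_frm, of EP EM E0] by (simp add: fprod_def)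
  from coact_mult[OF v(1) this]
  have 1: "fprod v (frag_of (1, ep * em * e0)) \<in> coact W (dif W x * e)"
    by (simp add: eq)
  have 2: "fprod (fmap2 id (dif W) u) (frag_of (1, e)) \<in> coact W (dif W x * e)"
    by (rule coact_mult[OF coact_dif[OF u] e])
  \<comment> \<open>Both terms represent the coaction on the same form, one computed from
    \<open>x\<close> and one from its coefficient \<open>y\<close>.\<close>
  have "fprod (fmap2 id (dif W) u) (frag_of (1, e)) - fprod v (frag_of (1, ep * em * e0))
      \<in> tnull (qsl2 W) (scalars W) UNIV"
    using coact_mem_iff[OF 1] 2 by blast
  then have "fmap2 id top_coeff (fprod (fmap2 id (dif W) u) (frag_of (1, e))
      - fprod (fmap2 id id v) (frag_of (1, ep * em * e0))) \<in> tnull (qsl2 W) (scalars W) UNIV"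
    by (intro fmap2_linear_tnull l.add l.scale) (simp add: fmap2_ident)
  \<comment> \<open>The right factors of \<open>v\<close> lie in \<open>qsl2 W\<close>, where
    \<open>top_coeff\<close> undoes multiplication by the top form.\<close>
  moreover have "fmap2 id (\<lambda>y. top_coeff (id y * (ep * em * e0))) v = v"
    using v(2) homog_subset_qsl2 top_coeff(2)
    by (subst (2) fmap2_ident[symmetric], intro fmap2_cong) auto
  ultimately have "fmap2 id (\<lambda>x. top_coeff (dif W x * e)) u - v \<in> tnull (qsl2 W) (scalars W) UNIV"
    by (simp add: fmap2_diff fmap2_fprod_frag_of)
  moreover have "Poly_Mapping.keys (fmap2 id (\<lambda>x. top_coeff (dif W x * e)) u) \<subseteq> qsl2 W \<times> UNIV"
    using keys_fmap2[of id "\<lambda>x. top_coeff (dif W x * e)" u] coact_keys[OF u] by force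
  ultimately show ?thesis
    using coact_mem_iff[OF v(1)] by blast
qed

section \<open>Covariance of the two derivatives and of the operator on each spinor bundle\<close>

lemma fmap2_fmap2: "fmap2 f g (fmap2 f' g' u) = fmap2 (f \<circ> f') (g \<circ> g') u"
  using subset_UNIV by (induction u rule: frag_induction) (auto simp: fmap2_diff)

lemma coact_frm2: "frag_of (1, frm W s * frm W t) \<in> coact W (frm W s * frm W t)"
  using coact_mult[OF coact_frm coact_frm, of s t] by (simp add: fprod_def)

lemma coact_dp:
  assumes x: "x \<in> homog W n" and u: "u \<in> coact W x"
  shows "fmap2 id dp u \<in> coact W (dp x)"
proof -
  have "dif W x * (em * e0) = dp x * (ep * em * e0)"
    by (simp add: dif_homog[OF x] distrib_right mult.assoc wedge_rules scale_simps)
  from coact_top_coeff[OF u coact_frm2 dp_homog[OF x] this] show ?thesis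
    by (simp add: dp_def[abs_def])
qed

lemma coact_dm:
  assumes x: "x \<in> homog W n" and u: "u \<in> coact W x"
  shows "fmap2 id dm u \<in> coact W (dm x)"
proof -
  have eq: "dif W x * (ep * e0) = (- (q\<^sup>2) \<cdot> dm x) * (ep * em * e0)"
    by (simp add: dif_homog[OF x] distrib_right mult.assoc wedge_rules scale_simps)
  have "fmap2 id dm u = fmap2 id (smult W (- inverse (q\<^sup>2))) (fmap2 id (\<lambda>x. top_coeff (dif W x * (ep * e0))) u)"
    unfolding fmap2_fmap2 by (simp add: dm_def[abs_def] comp_def id_def)
  also have "\<dots> \<in> coact W (- inverse (q\<^sup>2) \<cdot> - (q\<^sup>2) \<cdot> dm x)"
    by (intro coact_smult coact_top_coeff[OF u coact_frm2 homog_smult[OF dm_homog[OF x]] eq])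
  finally show ?thesis using q_nonzero by simp
qed

text \<open>On right factors of degree \<open>n\<close> the operator is a scalar multiple of
  \<open>dp\<close> or \<open>dm\<close>; the condition on keys gives exactly that degree.\<close>

lemma coact_dirac:
  assumes n: "n = 1 \<or> n = - 1" and x: "x \<in> homog W n" and u: "u \<in> coact W x"
    and keys: "Poly_Mapping.keys u \<subseteq> qsl2 W \<times> homog W n"
  shows "fmap2 id (dirac q W) u \<in> coact W (dirac q W x)"
  using n
proof
  assume [simp]: "n = 1"
  have "fmap2 id (dirac q W) u = fmap2 id (smult W (q powi (- 1))) (fmap2 id dp u)"
    unfolding fmap2_fmap2 by (rule fmap2_cong) (use keys in \<open>auto simp: dirac_minus qs_def\<close>)
  then show ?thesis
    using coact_smult[OF coact_dp[OF x u], of "q powi (- 1)"] x by (simp add: dirac_minus qs_def)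
next
  assume [simp]: "n = - 1"
  have "fmap2 id (dirac q W) u = fmap2 id (smult W (q powi 1)) (fmap2 id dm u)"
    unfolding fmap2_fmap2 by (rule fmap2_cong) (use keys in \<open>auto simp: dirac_plus qs_def\<close>)
  then show ?thesis
    using coact_smult[OF coact_dm[OF x u], of "q powi 1"] x by (simp add: dirac_plus qs_def)
qed

section \<open>Linearity and covariance on all spinors\<close>

lemma spinorsE:
  assumes "\<psi> \<in> spinors W"
  obtains \<sigma> \<tau> where "\<psi> = \<sigma> + \<tau>" "\<sigma> \<in> homog W 1" "\<tau> \<in> homog W (- 1)"
  using assms by (auto simp: spinors_def spinor_minus_def spinor_plus_def)

lemma homog_subset_spinors: "homog W 1 \<subseteq> spinors W" "homog W (- 1) \<subseteq> spinors W"
proof -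
  have "x + 0 \<in> spinors W" if "x \<in> homog W 1" for x
    unfolding spinors_def spinor_minus_def spinor_plus_def using that homog_zero by blast
  moreover have "0 + x \<in> spinors W" if "x \<in> homog W (- 1)" for x
    unfolding spinors_def spinor_minus_def spinor_plus_def using that homog_zero by blast
  ultimately show "homog W 1 \<subseteq> spinors W" "homog W (- 1) \<subseteq> spinors W" by auto
qed

lemma dirac_linear:
  assumes "\<psi> \<in> spinors W" "\<psi>' \<in> spinors W"
  shows "\<psi> + \<psi>' \<in> spinors W" "z \<cdot> \<psi> \<in> spinors W"
    "dirac q W (\<psi> + \<psi>') = dirac q W \<psi> + dirac q W \<psi>'" "dirac q W (z \<cdot> \<psi>) = z \<cdot> dirac q W \<psi>"
proof -
  obtain \<sigma> \<tau> where s: "\<psi> = \<sigma> + \<tau>" "\<sigma> \<in> homog W 1" "\<tau> \<in> homog W (- 1)"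
    using spinorsE[OF assms(1)] by blast
  obtain \<sigma>' \<tau>' where s': "\<psi>' = \<sigma>' + \<tau>'" "\<sigma>' \<in> homog W 1" "\<tau>' \<in> homog W (- 1)"
    using spinorsE[OF assms(2)] by blast
  have eq: "\<psi> + \<psi>' = (\<sigma> + \<sigma>') + (\<tau> + \<tau>')" "z \<cdot> \<psi> = z \<cdot> \<sigma> + z \<cdot> \<tau>"
    using s s' by (simp_all add: vs.scale_right_distrib)
  have mem: "\<sigma> + \<sigma>' \<in> homog W 1" "\<tau> + \<tau>' \<in> homog W (- 1)" "z \<cdot> \<sigma> \<in> homog W 1" "z \<cdot> \<tau> \<in> homog W (- 1)"
    using s s' by (simp_all add: homog_add homog_smult)
  show "\<psi> + \<psi>' \<in> spinors W" "z \<cdot> \<psi> \<in> spinors W"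
    using eq mem unfolding spinors_def spinor_minus_def spinor_plus_def by blast+
  show "dirac q W (\<psi> + \<psi>') = dirac q W \<psi> + dirac q W \<psi>'"
    unfolding eq dirac_eq[OF mem(1,2)] unfolding s(1) s'(1) dirac_eq[OF s(2,3)] dirac_eq[OF s'(2,3)]
    by (simp add: dpm_linear qs_simps add_ac)
  show "dirac q W (z \<cdot> \<psi>) = z \<cdot> dirac q W \<psi>"
    unfolding eq dirac_eq[OF mem(3,4)] unfolding s(1) dirac_eq[OF s(2,3)]
    by (simp add: dpm_linear qs_def vs.scale_right_distrib vs.scale_left_commute mult.commute)
qed

lemma spinors_subspace: "vs.subspace (spinors W)"
  using dirac_linear homog_subset_spinors homog_zero by (intro vs.subspaceI) blast+

text \<open>\<open>dirac\<close> is controlled only on spinors, while the relations in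
  \<open>tnull\<close> have arbitrary right factors. Composition with a linear projection onto the
  spinors gives a map that is linear everywhere.\<close>

lemma dirac_extend:
  obtains L where "\<And>x y. L (x + y) = L x + L y" "\<And>z x. L (z \<cdot> x) = z \<cdot> L x"
    "\<And>\<psi>. \<psi> \<in> spinors W \<Longrightarrow> L \<psi> = dirac q W \<psi>"
proof -
  interpret vp: vector_space_pair "smult W" "smult W" ..
  have "Vector_Spaces.linear (smult W) (smult W) (\<lambda>x. x)" by unfold_locales auto
  then obtain P where P: "range P \<subseteq> spinors W" "Vector_Spaces.linear (smult W) (smult W) P"
    "\<forall>\<psi>\<in>spinors W. P \<psi> = \<psi>"
    using vp.linear_exists_left_inverse_on[OF _ spinors_subspace, of "\<lambda>x. x"] by auto
  interpret P: Vector_Spaces.linear "smult W" "smult W" P by (rule P)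
  have mem: "P x \<in> spinors W" for x using P(1) by blast
  show ?thesis
    by (rule that[of "\<lambda>x. dirac q W (P x)"]) (simp_all add: P.add P.scale dirac_linear[OF mem mem] P(3))
qed

text \<open>A representative split by degree is treated first. Any other one with spinor right
  factors differs from it by a null sum, which the linear extension \<open>L\<close> maps to a null
  sum.\<close>

lemma dirac_covariant:
  assumes \<psi>: "\<psi> \<in> spinors W"
  shows "\<exists>u\<in>coact W \<psi>. Poly_Mapping.keys u \<subseteq> qsl2 W \<times> spinors W"
    and "\<And>u. u \<in> coact W \<psi> \<Longrightarrow> Poly_Mapping.keys u \<subseteq> qsl2 W \<times> spinors W \<Longrightarrow>
      fmap2 id (dirac q W) u \<in> coact W (dirac q W \<psi>)"
proof -
  obtain \<sigma> \<tau> where s: "\<psi> = \<sigma> + \<tau>" "\<sigma> \<in> homog W 1" "\<tau> \<in> homog W (- 1)"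
    using spinorsE[OF \<psi>] by blast
  obtain v where v: "v \<in> coact W \<sigma>" "Poly_Mapping.keys v \<subseteq> qsl2 W \<times> homog W 1"
    using coact_homog[OF s(2)] by blast
  obtain w where w: "w \<in> coact W \<tau>" "Poly_Mapping.keys w \<subseteq> qsl2 W \<times> homog W (- 1)"
    using coact_homog[OF s(3)] by blast
  have vw: "v + w \<in> coact W \<psi>" "Poly_Mapping.keys (v + w) \<subseteq> qsl2 W \<times> spinors W"
    using coact_add[OF v(1) w(1)] s v(2) w(2) keys_add[of v w] homog_subset_spinors by blast+
  then show "\<exists>u\<in>coact W \<psi>. Poly_Mapping.keys u \<subseteq> qsl2 W \<times> spinors W" by blast
  have dirac_vw: "fmap2 id (dirac q W) (v + w) \<in> coact W (dirac q W \<psi>)"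
    using coact_add[OF coact_dirac[OF _ s(2) v] coact_dirac[OF _ s(3) w]]
      dirac_linear(3)[of \<sigma> \<tau>] s homog_subset_spinors by (simp add: fmap2_add subset_eq)
  obtain L where L: "\<And>x y. L (x + y) = L x + L y" "\<And>z x. L (z \<cdot> x) = z \<cdot> L x"
    "\<And>\<psi>. \<psi> \<in> spinors W \<Longrightarrow> L \<psi> = dirac q W \<psi>"
    using dirac_extend by blast
  have fmap2_L: "fmap2 id (dirac q W) u = fmap2 id L u" if "Poly_Mapping.keys u \<subseteq> qsl2 W \<times> spinors W" for u
    by (rule fmap2_cong) (use that L(3) in auto)
  fix u assume u: "u \<in> coact W \<psi>" "Poly_Mapping.keys u \<subseteq> qsl2 W \<times> spinors W"
  have "u - (v + w) \<in> tnull (qsl2 W) (scalars W) UNIV"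
    using coact_mem_iff[OF vw(1)] u(1) by blast
  then have "fmap2 id L (u - (v + w)) \<in> tnull (qsl2 W) (scalars W) UNIV"
    by (rule fmap2_linear_tnull[OF _ L(1,2)])
  then have "fmap2 id (dirac q W) u - fmap2 id (dirac q W) (v + w) \<in> tnull (qsl2 W) (scalars W) UNIV"
    by (simp add: fmap2_L u(2) vw(2) fmap2_diff)
  moreover have "Poly_Mapping.keys (fmap2 id (dirac q W) u) \<subseteq> qsl2 W \<times> UNIV"
    using keys_fmap2[of id "dirac q W" u] u(2) by force
  ultimately show "fmap2 id (dirac q W) u \<in> coact W (dirac q W \<psi>)"
    using coact_mem_iff[OF dirac_vw] by blast
qed

text \<open>Projection sets one coefficient in \<open>clifford_tensor_rep\<close> to zero, and the
  Clifford action reads only the coefficient of the matching type; so the diagonal blocks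
  vanish.\<close>

lemma cov_deriv_parts:
  assumes n: "n = 1 \<or> n = - 1" and \<sigma>: "\<sigma> \<in> homog W n"
  shows "clifford W (cov_deriv10 q W n \<sigma>) = (if n = 1 then qs (- 1) (dp \<sigma>) else 0)"
    and "clifford W (cov_deriv01 q W n \<sigma>) = (if n = 1 then 0 else qs 1 (dm \<sigma>))"
  using clifford_tensor_rep[OF n dp_homog[OF \<sigma>] homog_zero] clifford_tensor_rep[OF n homog_zero dm_homog[OF \<sigma>]]
  by (auto simp: cov_deriv10_def cov_deriv01_def cov_deriv_eq[OF n \<sigma>] qs_simps
      tmap_left_proj[OF n dp_homog[OF \<sigma>] dm_homog[OF \<sigma>]])

end

theorem proposition5p5:
  fixes q :: complex and W :: "'w::ring_1 qcalc" and a b c d bm b0 bp :: 'w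
  assumes calc: "qsl2_calculus q W"
    and a: "a = gen W GA" and b: "b = gen W GB" and c: "c = gen W GC" and d: "d = gen W GD"
    and bm: "bm = a * b" and b0: "b0 = b * c" and bp: "bp = c * d"
  shows
    "(\<forall>\<sigma>\<in>spinor_minus W. \<exists>!t. is_cov_deriv q W 1 \<sigma> t) \<and>
     (\<forall>\<tau>\<in>spinor_plus W. \<exists>!t. is_cov_deriv q W (- 1) \<tau> t) \<and>
     (\<forall>\<sigma>\<in>spinor_minus W. clifford W (cov_deriv01 q W 1 \<sigma>) = 0) \<and>
     (\<forall>\<tau>\<in>spinor_plus W. clifford W (cov_deriv10 q W (- 1) \<tau>) = 0) \<and>
     (\<forall>\<sigma>\<in>spinor_minus W. \<forall>\<tau>\<in>spinor_plus W.
        dirac q W (\<sigma> + \<tau>) =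
          clifford W (cov_deriv01 q W (- 1) \<tau>) + clifford W (cov_deriv10 q W 1 \<sigma>)) \<and>
     spinor_minus W \<inter> spinor_plus W = {0} \<and>
     dirac q W ` spinor_minus W \<subseteq> spinor_plus W \<and>
     dirac q W ` spinor_plus W \<subseteq> spinor_minus W \<and>
     (\<forall>\<psi>\<in>spinors W. \<exists>u\<in>coact W \<psi>. Poly_Mapping.keys u \<subseteq> qsl2 W \<times> spinors W) \<and>
     (\<forall>\<psi>\<in>spinors W. \<forall>u\<in>coact W \<psi>. Poly_Mapping.keys u \<subseteq> qsl2 W \<times> spinors W \<longrightarrow>
        fmap2 id (dirac q W) u \<in> coact W (dirac q W \<psi>)) \<and>
     (\<forall>(f, r) \<in> {(bm, 0), (1 + (q + inverse q) \<cdot>\<^bsub>W\<^esub> b0, - (inverse q \<cdot>\<^bsub>W\<^esub> a)),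
                  (bp, - (inverse q \<cdot>\<^bsub>W\<^esub> c))}.
        dirac q W (dirac q W (f * a)) =
          (inverse q * (q + inverse q)) \<cdot>\<^bsub>W\<^esub> (laplacian W f * a) + r) \<and>
     (\<forall>(f, r) \<in> {(bm, 0), (1 + (q + inverse q) \<cdot>\<^bsub>W\<^esub> b0, q \<cdot>\<^bsub>W\<^esub> b), (bp, q \<cdot>\<^bsub>W\<^esub> d)}.
        dirac q W (dirac q W (f * b)) =
          (inverse q * (q + inverse q)) \<cdot>\<^bsub>W\<^esub> (laplacian W f * b) + r) \<and>
     (\<forall>(f, r) \<in> {(bm, a), (1 + (q + inverse q) \<cdot>\<^bsub>W\<^esub> b0, q \<cdot>\<^bsub>W\<^esub> c), (bp, 0)}.
        dirac q W (dirac q W (f * c)) =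
          (inverse q * (q + inverse q)) \<cdot>\<^bsub>W\<^esub> (laplacian W f * c) + r) \<and>
     (\<forall>(f, r) \<in> {(bm, - (q\<^sup>2 \<cdot>\<^bsub>W\<^esub> b)), (1 + (q + inverse q) \<cdot>\<^bsub>W\<^esub> b0, - (q ^ 3 \<cdot>\<^bsub>W\<^esub> d)),
                  (bp, 0)}.
        dirac q W (dirac q W (f * d)) =
          (inverse q * (q + inverse q)) \<cdot>\<^bsub>W\<^esub> (laplacian W f * d) + r)"
proof -
  interpret qsl2_calculus q W by (rule calc)
  \<comment> \<open>\<open>dp\<close> lowers the degree by two and \<open>dm\<close> raises it by
    two, which exchanges the degrees 1 and -1.\<close>
  have minus: "dirac q W \<sigma> \<in> homog W (- 1)" if "\<sigma> \<in> homog W 1" for \<sigma>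
    using that dp_homog[OF that] by (simp add: dirac_minus homog_qs)
  have plus: "dirac q W \<tau> \<in> homog W 1" if "\<tau> \<in> homog W (- 1)" for \<tau>
    using that dm_homog[OF that] by (simp add: dirac_plus homog_qs)
  show ?thesis
    unfolding spinor_minus_def spinor_plus_def a b c d bm b0 bp
  proof (intro conjI)
    show "homog W 1 \<inter> homog W (- 1) = {0}"
      using homog_disjoint[of _ 1 "- 1"] by auto
  qed (use dirac_covariant minus plus in \<open>auto simp: is_cov_deriv_iff cov_deriv_parts dirac_eq
      dirac_square_formulas add.commute\<close>)
qed

end
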